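(* Let $\tau > \sqrt{6}$ and let $\rho_{\min}$ be a minimizing measure of the causal variational principle on the sphere $S^2$ with parameter $\tau$. Then the support of $\rho_{\min}$ is totally disconnected and has Hausdorff dimension at most $6/7$.
   Context: Let $S^2 \subset \mathbb{R}^3$ be the unit sphere and $\langle x,y\rangle$ the Euclidean scalar product of $x,y \in S^2$. For a parameter $\tau \in [1,\infty)$ define $\mathcal{D}(x,y) = \frac14 (1+\langle x,y\rangle)\,\big(2-\tau^2(1-\langle x,y\rangle)\big)$ and the Lagrangian $\mathcal{L}(x,y) = \max(0,\mathcal{D}(x,y))$ for $x,y\in S^2$. The causal variational principle on the sphere is to minimize the action $\mathcal{S}(\rho)=\int_{S^2} d\rho(x)\int_{S^2} d\rho(y)\,\mathcal{L}(x,y)$ within the class of normalized (i.e. $\rho(S^2)=1$) regular Borel measures on $S^2$. A minimizing measure is a minimizer $\rho_{\min}$ in this class. *)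

theory Defs
  imports "HOL-Analysis.Analysis"
begin

abbreviation S2 :: "(real^3) set" where
  "S2 \<equiv> sphere 0 1"

definition D_fun :: "real \<Rightarrow> real^3 \<Rightarrow> real^3 \<Rightarrow> real" where
  "D_fun \<tau> x y = 1/4 * (1 + x \<bullet> y) * (2 - \<tau>\<^sup>2 * (1 - x \<bullet> y))"

definition Lagrangian :: "real \<Rightarrow> real^3 \<Rightarrow> real^3 \<Rightarrow> real" where
  "Lagrangian \<tau> x y = max 0 (D_fun \<tau> x y)"

text \<open>Inner and outer regularity, where open means relatively open in the underlying space.\<close>

definition regular_measure :: "'a::topological_space measure \<Rightarrow> bool" where
  "regular_measure M \<longleftrightarrow> (\<forall>B\<in>sets M.
     emeasure M B = (SUP K\<in>{K. compact K \<and> K \<subseteq> B}. emeasure M K) \<and>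
     emeasure M B = (INF U\<in>{U. openin (top_of_set (space M)) U \<and> B \<subseteq> U}. emeasure M U))"

definition normalized_regular_borel :: "(real^3) measure \<Rightarrow> bool" where
  "normalized_regular_borel \<rho> \<longleftrightarrow>
     sets \<rho> = sets (restrict_space borel S2) \<and> regular_measure \<rho> \<and> emeasure \<rho> S2 = 1"

text \<open>Regularity is automatic for normalized Borel measures on the sphere.\<close>

lemma regular_measure_S2:
  fixes M :: "(real^3) measure"
  assumes s: "sets M = sets (restrict_space borel S2)" and e: "emeasure M S2 = 1"
  shows "regular_measure M"
proof -
  have sp: "space M = S2" using sets_eq_imp_space_eq[OF s] by (simp add: space_restrict_space)
  have S2b: "S2 \<in> sets borel" by simp
  define N where "N = distr M borel (\<lambda>x. x)"
  have id: "(\<lambda>x. x) \<in> measurable M borel"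
    using measurable_restrict_space1[of "\<lambda>x. x" borel borel S2] s measurable_cong_sets by auto
  have N: "emeasure N B = emeasure M (B \<inter> S2)" if "B \<in> sets borel" for B
    unfolding N_def using emeasure_distr[OF id that] sp by simp
  have fin: "emeasure N (space N) \<noteq> \<infinity>" using N[of UNIV] e by (simp add: N_def)
  have sN: "sets N = sets borel" by (simp add: N_def)
  show ?thesis unfolding regular_measure_def
  proof (intro ballI conjI)
    fix B assume B: "B \<in> sets M"
    have Bb: "B \<in> sets borel" "B \<subseteq> S2"
      using B s sets_restrict_space_iff[of S2 borel B] sp sets.sets_into_space by auto
    have MB: "emeasure M B = emeasure N B" using N[OF Bb(1)] Bb(2) by (simp add: Int_absorb2)
    show "emeasure M B = (SUP K\<in>{K. compact K \<and> K \<subseteq> B}. emeasure M K)"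
      unfolding MB inner_regular[OF sN fin Bb(1)]
    proof (rule SUP_cong)
      fix K assume "K \<in> {K. compact K \<and> K \<subseteq> B}"
      then have "K \<in> sets borel" "K \<inter> S2 = K"
        using Bb by (auto intro: borel_compact)
      then show "emeasure N K = emeasure M K"
        using N[of K] by simp
    qed auto
    show "emeasure M B = (INF U\<in>{U. openin (top_of_set (space M)) U \<and> B \<subseteq> U}. emeasure M U)"
      unfolding MB outer_regular[OF sN fin Bb(1)] sp
    proof (rule INF_eq)
      fix U assume "U \<in> {U. B \<subseteq> U \<and> open U}"
      then show "\<exists>V\<in>{U. openin (top_of_set S2) U \<and> B \<subseteq> U}. emeasure M V \<le> emeasure N U"
        using Bb N[of U] by (intro bexI[of _ "S2 \<inter> U"]) (auto simp: Int_commute openin_open_Int[of U S2, unfolded Int_commute[of S2]])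
    next
      fix U assume "U \<in> {U. openin (top_of_set S2) U \<and> B \<subseteq> U}"
      then obtain V where "open V" "U = S2 \<inter> V" "B \<subseteq> U" by (auto simp: openin_open)
      then show "\<exists>V\<in>{U. B \<subseteq> U \<and> open U}. emeasure N V \<le> emeasure M U"
        using N[of V] by (intro bexI[of _ V]) (auto simp: Int_commute)
    qed
  qed
qed

definition action :: "real \<Rightarrow> (real^3) measure \<Rightarrow> real" where
  "action \<tau> \<rho> = (LINT x|\<rho>. LINT y|\<rho>. Lagrangian \<tau> x y)"

definition minimizing_measure :: "real \<Rightarrow> (real^3) measure \<Rightarrow> bool" where
  "minimizing_measure \<tau> \<rho> \<longleftrightarrow> normalized_regular_borel \<rho> \<and>
     (\<forall>\<sigma>. normalized_regular_borel \<sigma> \<longrightarrow> action \<tau> \<rho> \<le> action \<tau> \<sigma>)"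

definition measure_supp :: "'a::topological_space measure \<Rightarrow> 'a set" where
  "measure_supp M =
     {x \<in> space M. \<forall>U. openin (top_of_set (space M)) U \<and> x \<in> U \<longrightarrow> emeasure M U > 0}"

definition totally_disconnected :: "'a::topological_space set \<Rightarrow> bool" where
  "totally_disconnected S \<longleftrightarrow> (\<forall>C. C \<subseteq> S \<and> connected C \<longrightarrow> C = {} \<or> (\<exists>x. C = {x}))"

text \<open>The \<open>s\<close>-th power of the diameter with the conventions \<open>diam {} ^ s = 0\<close> and
  \<open>0 ^ 0 = 1\<close> for nonempty sets (whereas \<open>0 powr 0 = 0\<close> in HOL).\<close>

definition diam_pow :: "real \<Rightarrow> 'a::metric_space set \<Rightarrow> real" where
  "diam_pow s E = (if E = {} then 0 else if s = 0 then 1 else diameter E powr s)"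

text \<open>Boundedness is required explicitly because \<open>diameter\<close> is unspecified on unbounded sets.\<close>

definition hausdorff_premeasure :: "real \<Rightarrow> real \<Rightarrow> 'a::metric_space set \<Rightarrow> ennreal" where
  "hausdorff_premeasure s \<delta> A =
     (INF E\<in>{E :: nat \<Rightarrow> 'a set. A \<subseteq> (\<Union>i. E i) \<and> (\<forall>i. bounded (E i) \<and> diameter (E i) \<le> \<delta>)}.
        (\<Sum>i. ennreal (diam_pow s (E i))))"

definition hausdorff_measure :: "real \<Rightarrow> 'a::metric_space set \<Rightarrow> ennreal" where
  "hausdorff_measure s A = (SUP \<delta>\<in>{0<..}. hausdorff_premeasure s \<delta> A)"

text \<open>Extended-real valued, so that the infimum is infinite if no such \<open>s\<close> exists.\<close>

definition hausdorff_dim :: "'a::metric_space set \<Rightarrow> ereal" where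
  "hausdorff_dim A = (INF s\<in>{s::real. 0 \<le> s \<and> hausdorff_measure s A = 0}. ereal s)"

end

theory Submission
  imports Defs
begin

text \<open>The support \<open>K\<close> of a minimizer turns out to be finite, which gives both claims: a finite set has only
trivial connected subsets and Hausdorff dimension zero. Write \<open>L\<close> and \<open>D\<close> for the Lagrangian and for the
polynomial kernel of which it is the positive part, and let the potential of \<open>x\<close> be the integral
of \<open>L(x,y)\<close> over \<open>y\<close>.

Minimality of first order says that the potential is minimal on the whole sphere at the points of \<open>K\<close>
(\<open>S_le_potential\<close>, \<open>potential_on_K\<close>). Minimality of second order says that \<open>L\<close> is a positive
semidefinite kernel on \<open>K\<close> (\<open>Lagrangian_positive_semidefinite\<close>).

The kernel \<open>D(x,y)\<close> is a quadratic polynomial in \<open>x\<close>, hence linear in the vector \<open>veronese x\<close>, which lives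
in a space of finite dimension. Points \<open>p\<^sub>i\<close> of \<open>K\<close> that lie close together satisfy \<open>L(p\<^sub>i,p\<^sub>j) = D(p\<^sub>i,p\<^sub>j)\<close>, so a
linear relation between their Veronese vectors is a null vector of the positive semidefinite matrix
\<open>L(p\<^sub>i,p\<^sub>j)\<close>. A null vector of a semidefinite form is orthogonal to everything, so the same
relation holds between the functions \<open>L(p\<^sub>i,y)\<close> for every \<open>y \<in> K\<close>, although \<open>L\<close> is not polynomial
(\<open>Lagrangian_null_combination\<close>). Suppose now that \<open>K\<close> is infinite. Among its infinite subsets choose
one whose Veronese vectors span a space of least dimension; then every infinite part of it spans the same space,
and it contains an injective sequence \<open>X\<close> that converges to some \<open>x\<close> (\<open>minimal_span_sequence\<close>). This
minimality replaces the irreducibility of an algebraic curve: for each \<open>y \<in> K\<close> the numbers \<open>D(X\<^sub>k,y)\<close>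
have one sign, and they vanish for all \<open>k\<close> or for finitely many \<open>k\<close> only (\<open>sign_dichotomy\<close>).

Let \<open>P\<close> be the set of those \<open>y\<close> for which some \<open>D(X\<^sub>k,y)\<close> is positive, let \<open>z = X\<^sub>0\<close>, and let \<open>w\<close> be the tangent
vector at \<open>x\<close> that points to \<open>z\<close>. For \<open>\<tau> > \<surd>6\<close> the function \<open>D(\<cdot>,y)\<close> is strictly concave along every great circle
through \<open>x\<close> when \<open>x\<close> lies in the closed light cone of \<open>y\<close> (\<open>D_fun_concave\<close>). The potential takes the same value
at \<open>x\<close> and at \<open>z\<close>, and the difference of these values is the integral of \<open>D(z,y) - D(x,y)\<close> over \<open>P\<close>;
by concavity the integral over \<open>P\<close> of the derivative of \<open>D(\<cdot>,y)\<close> at \<open>x\<close> in direction \<open>w\<close> is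
strictly positive. On the other hand the potential cannot decrease when one starts at \<open>X\<^sub>k\<close> and moves in
direction \<open>-w\<close>. As \<open>k\<close> tends to infinity, the points \<open>y\<close> outside \<open>P\<close> stop contributing to that
derivative: either \<open>D(X\<^sub>k,y) < 0\<close> eventually, or \<open>D(X\<^sub>k,y) = 0\<close> for all \<open>k\<close>, and then concavity shows that \<open>D(\<cdot>,y)\<close>
increases towards \<open>z\<close>, so that it becomes negative in direction \<open>-w\<close>. Hence the same integral over \<open>P\<close> is at most
zero, a contradiction (\<open>finite_support\<close>).\<close>

section \<open>The Lagrangian as a function of the scalar product\<close>

definition profile :: "real \<Rightarrow> real \<Rightarrow> real" where
  "profile \<tau> t = (2 - \<tau>\<^sup>2 + 2 * t + \<tau>\<^sup>2 * t\<^sup>2) / 4"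

definition profile' :: "real \<Rightarrow> real \<Rightarrow> real" where
  "profile' \<tau> t = (1 + \<tau>\<^sup>2 * t) / 2"

lemma D_fun_eq_profile: "D_fun \<tau> x y = profile \<tau> (x \<bullet> y)"
  by (simp add: D_fun_def profile_def power2_eq_square field_simps)

lemma D_fun_commute: "D_fun \<tau> x y = D_fun \<tau> y x"
  by (simp add: D_fun_def inner_commute)

lemma Lagrangian_commute: "Lagrangian \<tau> x y = Lagrangian \<tau> y x"
  by (simp add: Lagrangian_def D_fun_commute)

lemma D_fun_refl: "x \<in> S2 \<Longrightarrow> D_fun \<tau> x x = 1"
  by (simp add: D_fun_def dot_square_norm)

lemma inner_sphere_bound:
  fixes x y :: "real^3"
  assumes "x \<in> S2" "y \<in> S2"
  shows "\<bar>x \<bullet> y\<bar> \<le> 1"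
  using Cauchy_Schwarz_ineq2[of x y] assms by simp

lemma profile_le_1:
  assumes "\<bar>t\<bar> \<le> 1"
  shows "profile \<tau> t \<le> 1"
proof -
  have "t\<^sup>2 \<le> 1" using assms by (simp add: abs_square_le_1)
  then have "0 \<le> 2 * (1 - t) + \<tau>\<^sup>2 * (1 - t\<^sup>2)"
    using assms by (intro add_nonneg_nonneg mult_nonneg_nonneg) auto
  then show ?thesis by (simp add: profile_def algebra_simps)
qed

lemma Lagrangian_bounds:
  assumes "x \<in> S2" "y \<in> S2"
  shows "0 \<le> Lagrangian \<tau> x y" "Lagrangian \<tau> x y \<le> 1" "\<bar>Lagrangian \<tau> x y\<bar> \<le> 1"
  using profile_le_1[OF inner_sphere_bound[OF assms], of \<tau>]
  by (auto simp: Lagrangian_def D_fun_eq_profile)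

lemma D_fun_Lipschitz:
  assumes "x \<in> S2" "x' \<in> S2" "y \<in> S2"
  shows "\<bar>D_fun \<tau> x y - D_fun \<tau> x' y\<bar> \<le> (1 + \<tau>\<^sup>2) / 2 * dist x x'"
proof -
  let ?t = "x \<bullet> y" and ?s = "x' \<bullet> y"
  have ts: "\<bar>?t\<bar> \<le> 1" "\<bar>?s\<bar> \<le> 1" using inner_sphere_bound assms by auto
  have "\<bar>?t - ?s\<bar> \<le> dist x x'"
    using Cauchy_Schwarz_ineq2[of "x - x'" y] assms by (simp add: inner_diff_left dist_norm)
  moreover have "\<bar>2 + \<tau>\<^sup>2 * (?t + ?s)\<bar> \<le> 2 + \<tau>\<^sup>2 * 2"
  proof -
    have "\<bar>\<tau>\<^sup>2 * (?t + ?s)\<bar> \<le> \<tau>\<^sup>2 * 2"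
      unfolding abs_mult using ts by (intro mult_mono) auto
    then show ?thesis by linarith
  qed
  ultimately have "\<bar>?t - ?s\<bar> * \<bar>2 + \<tau>\<^sup>2 * (?t + ?s)\<bar> \<le> dist x x' * (2 + \<tau>\<^sup>2 * 2)"
    by (intro mult_mono) auto
  moreover have "D_fun \<tau> x y - D_fun \<tau> x' y = (?t - ?s) * (2 + \<tau>\<^sup>2 * (?t + ?s)) / 4"
    by (simp add: D_fun_eq_profile profile_def power2_eq_square field_simps)
  then have "\<bar>D_fun \<tau> x y - D_fun \<tau> x' y\<bar> = \<bar>?t - ?s\<bar> * \<bar>2 + \<tau>\<^sup>2 * (?t + ?s)\<bar> / 4"
    by (simp only: abs_mult abs_divide abs_numeral)
  ultimately have "\<bar>D_fun \<tau> x y - D_fun \<tau> x' y\<bar> \<le> dist x x' * (2 + \<tau>\<^sup>2 * 2) / 4"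
    by linarith
  then show ?thesis by (simp add: field_simps)
qed

lemma Lagrangian_Lipschitz:
  assumes "x \<in> S2" "x' \<in> S2" "y \<in> S2"
  shows "\<bar>Lagrangian \<tau> x y - Lagrangian \<tau> x' y\<bar> \<le> (1 + \<tau>\<^sup>2) / 2 * dist x x'"
  using D_fun_Lipschitz[OF assms, of \<tau>] unfolding Lagrangian_def by linarith

lemma measurable_Lagrangian [measurable]:
  assumes [measurable]: "f \<in> borel_measurable M" "g \<in> borel_measurable M"
  shows "(\<lambda>p. Lagrangian \<tau> (f p) (g p)) \<in> borel_measurable M"
  unfolding Lagrangian_def D_fun_def by measurable

section \<open>Competing measures\<close>

lemma normalized_regular_borelD:
  assumes "normalized_regular_borel \<sigma>"
  shows "sets \<sigma> = sets (restrict_space borel S2)" "space \<sigma> = S2" "finite_measure \<sigma>"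
    "measure \<sigma> (space \<sigma>) = 1" "(\<lambda>x. x) \<in> borel_measurable \<sigma>"
proof -
  show 1: "sets \<sigma> = sets (restrict_space borel S2)"
    using assms by (simp add: normalized_regular_borel_def)
  show 2: "space \<sigma> = S2"
    using sets_eq_imp_space_eq[OF 1] by (simp add: space_restrict_space)
  show "finite_measure \<sigma>" "measure \<sigma> (space \<sigma>) = 1"
    using assms 2 by (auto simp: normalized_regular_borel_def measure_def intro: finite_measureI)
  show "(\<lambda>x. x) \<in> borel_measurable \<sigma>"
    using measurable_restrict_space1[of "\<lambda>x. x" borel borel S2] 1 measurable_cong_sets by auto
qed

lemma normalized_regular_borelI:
  assumes "sets \<sigma> = sets (restrict_space borel S2)" "emeasure \<sigma> S2 = 1"
  shows "normalized_regular_borel \<sigma>"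
  using assms regular_measure_S2 by (simp add: normalized_regular_borel_def)

lemma integrable_bounded_on_S2:
  fixes f :: "real^3 \<Rightarrow> real"
  assumes \<sigma>: "normalized_regular_borel \<sigma>" and f: "f \<in> borel_measurable \<sigma>"
    and B: "\<And>x. x \<in> S2 \<Longrightarrow> \<bar>f x\<bar> \<le> B"
  shows "integrable \<sigma> f"
  by (rule finite_measure.integrable_const_bound[OF normalized_regular_borelD(3)[OF \<sigma>], where B=B])
     (use f B normalized_regular_borelD(2)[OF \<sigma>] in auto)

text \<open>The mixture \<open>(1 - t) \<rho> + t \<delta>\<^sub>z\<close>, obtained as the law of a point that is \<open>z\<close> if a biased coin shows heads and
is drawn from \<open>\<rho>\<close> otherwise; in this form its integrals follow from Fubini's theorem.\<close>

lemma mixture_with_point_mass: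
  assumes \<rho>: "normalized_regular_borel \<rho>" and z: "z \<in> S2" and t: "0 \<le> t" "t \<le> 1"
  obtains \<sigma> where "normalized_regular_borel \<sigma>"
    and "\<And>f :: real^3 \<Rightarrow> real. \<And>B. f \<in> borel_measurable borel \<Longrightarrow> (\<And>x. x \<in> S2 \<Longrightarrow> \<bar>f x\<bar> \<le> B) \<Longrightarrow>
           (LINT x|\<sigma>. f x) = (1 - t) * (LINT x|\<rho>. f x) + t * f z"
proof -
  note [measurable] = normalized_regular_borelD(5)[OF \<rho>]
  interpret R: finite_measure \<rho> by (rule normalized_regular_borelD(3)[OF \<rho>])
  define w where "w = (\<lambda>b::bool. if b then t else 1 - t)"
  define C where "C = point_measure (UNIV::bool set) w"
  have w0: "0 \<le> w b" for b using t by (simp add: w_def)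
  have sC [measurable_cong]: "sets C = sets (count_space UNIV)"
    by (simp add: C_def sets_point_measure)
  interpret C: finite_measure C
    by (rule finite_measureI) (simp add: C_def space_point_measure emeasure_point_measure_finite)
  interpret P: pair_sigma_finite C \<rho> ..
  define c where "c = (\<lambda>(b, y). if b then z else y)"
  have [measurable]: "c \<in> (C \<Otimes>\<^sub>M \<rho>) \<rightarrow>\<^sub>M borel" unfolding c_def by measurable
  have cr: "c \<in> (C \<Otimes>\<^sub>M \<rho>) \<rightarrow>\<^sub>M restrict_space borel S2"
    by (rule measurable_restrict_space2)
       (auto simp: c_def space_pair_measure normalized_regular_borelD(2)[OF \<rho>] z[simplified])
  define \<sigma> where "\<sigma> = distr (C \<Otimes>\<^sub>M \<rho>) (restrict_space borel S2) c"
  have spC: "space C = UNIV" by (simp add: C_def space_point_measure)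
  have int: "(LINT x|\<sigma>. f x) = (1 - t) * (LINT x|\<rho>. f x) + t * f z"
    if [measurable]: "f \<in> borel_measurable borel" and B: "\<And>x. x \<in> S2 \<Longrightarrow> \<bar>f x\<bar> \<le> B" 
    for f :: "real^3 \<Rightarrow> real" and B
  proof -
    have fc: "norm (f (c p)) \<le> B" if "p \<in> space (C \<Otimes>\<^sub>M \<rho>)" for p
      using that B z normalized_regular_borelD(2)[OF \<rho>]
      by (cases p) (auto simp: c_def space_pair_measure abs_le_iff minus_le_iff)
    have ii: "integrable (C \<Otimes>\<^sub>M \<rho>) (\<lambda>p. f (c p))"
    proof (rule integrableI_bounded_set[where A="space (C \<Otimes>\<^sub>M \<rho>)" and B=B])
      show "emeasure (C \<Otimes>\<^sub>M \<rho>) (space (C \<Otimes>\<^sub>M \<rho>)) < \<infinity>"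
        by (simp add: space_pair_measure R.emeasure_pair_measure_Times ennreal_mult_eq_top_iff flip: top.not_eq_extremum)
    qed (use fc in \<open>auto intro!: AE_I2\<close>)
    have "(LINT x|\<sigma>. f x) = (LINT p|(C \<Otimes>\<^sub>M \<rho>). f (c p))"
      unfolding \<sigma>_def by (rule integral_distr[OF cr]) (auto intro: measurable_restrict_space1)
    also have "\<dots> = (LINT b|C. LINT y|\<rho>. f (c (b, y)))"
      using P.integral_fst'[OF ii] by simp
    also have "\<dots> = (\<Sum>b\<in>UNIV. w b * (LINT y|\<rho>. f (c (b, y))))"
      unfolding C_def by (subst lebesgue_integral_point_measure_finite) (auto simp: w0)
    also have "\<dots> = (1 - t) * (LINT x|\<rho>. f x) + t * f z"
      using normalized_regular_borelD(4)[OF \<rho>] by (simp add: UNIV_bool w_def c_def)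
    finally show ?thesis .
  qed
  have "emeasure \<sigma> S2 = emeasure (C \<Otimes>\<^sub>M \<rho>) (space (C \<Otimes>\<^sub>M \<rho>))"
    unfolding \<sigma>_def by (subst emeasure_distr[OF cr])
      (auto simp: sets_restrict_space c_def space_pair_measure normalized_regular_borelD(2)[OF \<rho>] z[simplified]
        intro!: arg_cong2[where f=emeasure])
  also have "\<dots> = emeasure C UNIV * emeasure \<rho> (space \<rho>)"
    by (simp add: space_pair_measure R.emeasure_pair_measure_Times spC)
  also have "emeasure C UNIV = 1"
    unfolding C_def by (subst emeasure_point_measure_finite)
      (use t in \<open>auto simp: UNIV_bool w_def simp flip: ennreal_plus ennreal_1\<close>)
  also have "emeasure \<rho> (space \<rho>) = 1"
    using \<rho> normalized_regular_borelD(2)[OF \<rho>] by (simp add: normalized_regular_borel_def)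
  finally have "normalized_regular_borel \<sigma>"
    by (intro normalized_regular_borelI) (simp_all add: \<sigma>_def)
  then show ?thesis using int that by blast
qed

lemma density_competitor:
  assumes \<rho>: "normalized_regular_borel \<rho>" and [measurable]: "g \<in> borel_measurable \<rho>"
    and g: "\<And>x. x \<in> S2 \<Longrightarrow> 0 \<le> g x" and ig: "integrable \<rho> g" "(LINT x|\<rho>. g x) = 1"
  shows "normalized_regular_borel (density \<rho> g)"
proof (rule normalized_regular_borelI)
  note sp = normalized_regular_borelD(2)[OF \<rho>]
  show "sets (density \<rho> g) = sets (restrict_space borel S2)"
    using normalized_regular_borelD(1)[OF \<rho>] by simp
  have "emeasure (density \<rho> g) S2 = (\<integral>\<^sup>+x. ennreal (g x) \<partial>\<rho>)"
    by (subst emeasure_density) (auto simp: sp simp flip: sp intro!: nn_integral_cong)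
  also have "\<dots> = ennreal (LINT x|\<rho>. g x)"
    by (rule nn_integral_eq_integral) (use ig g sp in auto)
  finally show "emeasure (density \<rho> g) S2 = 1" using ig by simp
qed

locale sphere_minimizer =
  fixes \<tau> :: real and \<rho> :: "(real^3) measure"
  assumes minimizing: "minimizing_measure \<tau> \<rho>"
begin

abbreviation L :: "real^3 \<Rightarrow> real^3 \<Rightarrow> real" where "L \<equiv> Lagrangian \<tau>"
abbreviation D :: "real^3 \<Rightarrow> real^3 \<Rightarrow> real" where "D \<equiv> D_fun \<tau>"
abbreviation K :: "(real^3) set" where "K \<equiv> measure_supp \<rho>"

definition potential :: "real^3 \<Rightarrow> real" where
  "potential x = (LINT y|\<rho>. L x y)"

definition S :: real where "S = action \<tau> \<rho>"

lemma normalized: "normalized_regular_borel \<rho>"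
  using minimizing by (simp add: minimizing_measure_def)

lemmas sets_\<rho> = normalized_regular_borelD(1)[OF normalized]
lemmas space_\<rho> [simp] = normalized_regular_borelD(2)[OF normalized]
lemmas id_measurable [measurable] = normalized_regular_borelD(5)[OF normalized]
lemmas integrable_bounded = integrable_bounded_on_S2[OF normalized]

sublocale finite_measure \<rho> by (rule normalized_regular_borelD(3)[OF normalized])
sublocale pair: pair_sigma_finite \<rho> \<rho> ..

lemma measure_S2 [simp]: "measure \<rho> S2 = 1"
  using normalized_regular_borelD(4)[OF normalized] by simp

lemma minimal: "normalized_regular_borel \<sigma> \<Longrightarrow> S \<le> action \<tau> \<sigma>"
  using minimizing by (simp add: minimizing_measure_def S_def)

lemma Borel_measurable [measurable (raw)]:
  "f \<in> borel_measurable borel \<Longrightarrow> f \<in> borel_measurable \<rho>"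
  using measurable_compose[OF id_measurable] by simp

lemma borel_section: "A \<in> sets borel \<Longrightarrow> A \<inter> S2 \<in> sets \<rho>"
  unfolding sets_\<rho> by (auto simp: sets_restrict_space)

lemma S_eq: "S = (LINT x|\<rho>. potential x)"
  by (simp add: S_def action_def potential_def)

lemma measurable_potential [measurable]: "potential \<in> borel_measurable borel"
  unfolding potential_def by measurable

lemma integrable_L: "x \<in> S2 \<Longrightarrow> integrable \<rho> (L x)"
  by (rule integrable_bounded[where B=1]) (use Lagrangian_bounds(3) in auto)

lemma abs_integral_le_bound:
  fixes f :: "real^3 \<Rightarrow> real"
  assumes [measurable]: "f \<in> borel_measurable \<rho>" and "\<And>x. x \<in> S2 \<Longrightarrow> \<bar>f x\<bar> \<le> B"
  shows "\<bar>LINT x|\<rho>. f x\<bar> \<le> B"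
proof -
  have "\<bar>LINT x|\<rho>. f x\<bar> \<le> (LINT x|\<rho>. \<bar>f x\<bar>)"
    by (rule integral_abs_bound)
  also have "\<dots> \<le> (LINT x|\<rho>. B)"
    by (intro integral_mono integrable_bounded[where B=B]) 
       (use assms assms(2)[THEN order_trans[OF abs_ge_zero]] in auto)
  finally show ?thesis by simp
qed

lemma potential_bound: "x \<in> S2 \<Longrightarrow> \<bar>potential x\<bar> \<le> 1"
  unfolding potential_def by (rule abs_integral_le_bound) (use Lagrangian_bounds(3) in auto)

lemma integrable_potential: "integrable \<rho> potential"
  by (rule integrable_bounded[where B=1]) (use potential_bound in auto)

lemma potential_Lipschitz:
  assumes "x \<in> S2" "x' \<in> S2"
  shows "\<bar>potential x - potential x'\<bar> \<le> (1 + \<tau>\<^sup>2) / 2 * dist x x'"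
proof -
  have "potential x - potential x' = (LINT y|\<rho>. L x y - L x' y)"
    unfolding potential_def using assms integrable_L by (simp add: Bochner_Integration.integral_diff)
  also have "\<bar>\<dots>\<bar> \<le> (1 + \<tau>\<^sup>2) / 2 * dist x x'"
    by (rule abs_integral_le_bound) (use assms Lagrangian_Lipschitz in auto)
  finally show ?thesis .
qed

section \<open>Euler--Lagrange conditions\<close>

text \<open>The constant \<open>S\<close> is the minimal action; the first variation identifies it with the value of the potential on \<open>K\<close>.\<close>

lemma S_nonneg: "0 \<le> S"
  unfolding S_eq potential_def 
  by (intro integral_nonneg_AE AE_I2) (use Lagrangian_bounds(1) in auto)

text \<open>Moving a little mass to \<open>z\<close> changes the action by \<open>2 t (potential z - S)\<close> to first order in the mass \<open>t\<close>, and this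
change cannot be negative.\<close>

lemma S_le_potential:
  assumes z: "z \<in> S2"
  shows "S \<le> potential z"
proof -
  have ineq: "0 \<le> 2 * (potential z - S) + t * (S - 2 * potential z + L z z)" if t: "0 < t" "t \<le> 1" for t
  proof -
    obtain \<sigma> where \<sigma>: "normalized_regular_borel \<sigma>"
      and int: "\<And>f :: real^3 \<Rightarrow> real. \<And>B. f \<in> borel_measurable borel \<Longrightarrow> (\<And>x. x \<in> S2 \<Longrightarrow> \<bar>f x\<bar> \<le> B) \<Longrightarrow>
           (LINT x|\<sigma>. f x) = (1 - t) * (LINT x|\<rho>. f x) + t * f z"
      using mixture_with_point_mass[OF normalized z, of t] t by auto
    interpret \<sigma>: finite_measure \<sigma> by (rule normalized_regular_borelD(3)[OF \<sigma>])
    have sp: "space \<sigma> = S2" by (rule normalized_regular_borelD(2)[OF \<sigma>])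
    have inner: "(LINT y|\<sigma>. L x y) = (1 - t) * potential x + t * L x z" if "x \<in> S2" for x
      unfolding potential_def by (rule int[where B=1]) (use that Lagrangian_bounds(3) in auto)
    have iz: "integrable \<rho> (\<lambda>x. L x z)" 
      by (rule integrable_bounded[where B=1]) (use z Lagrangian_bounds(3) in auto)
    have "action \<tau> \<sigma> = (LINT x|\<sigma>. (1 - t) * potential x + t * L x z)"
      unfolding action_def by (rule Bochner_Integration.integral_cong) (use inner sp in auto)
    also have "\<dots> = (1 - t) * (LINT x|\<rho>. (1 - t) * potential x + t * L x z)
                      + t * ((1 - t) * potential z + t * L z z)"
    proof (rule int[where B=1])
      fix x assume x: "x \<in> S2"
      have "\<bar>(1 - t) * potential x + t * L x z\<bar> \<le> (1 - t) * \<bar>potential x\<bar> + t * \<bar>L x z\<bar>"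
        using t by (intro order_trans[OF abs_triangle_ineq]) (simp add: abs_mult)
      also have "\<dots> \<le> (1 - t) * 1 + t * 1"
        using t x z potential_bound Lagrangian_bounds(3) by (intro add_mono mult_left_mono) auto
      finally show "\<bar>(1 - t) * potential x + t * L x z\<bar> \<le> 1" by simp
    qed measurable
    also have "(LINT x|\<rho>. (1 - t) * potential x + t * L x z) = (1 - t) * S + t * potential z"
      using iz integrable_potential
      by (simp add: S_eq potential_def[of z] Lagrangian_commute[of \<tau> z])
    finally have "S \<le> (1 - t) * ((1 - t) * S + t * potential z) + t * ((1 - t) * potential z + t * L z z)"
      using minimal[OF \<sigma>] by simp
    then have "0 \<le> t * (2 * (potential z - S) + t * (S - 2 * potential z + L z z))"
      by (simp add: algebra_simps)
    then show ?thesis using t by (simp add: zero_le_mult_iff)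
  qed
  have "((\<lambda>t. 2 * (potential z - S) + t * (S - 2 * potential z + L z z)) \<longlongrightarrow>
          2 * (potential z - S) + 0 * (S - 2 * potential z + L z z)) (at_right 0)"
    by (intro tendsto_intros)
  then have "0 \<le> 2 * (potential z - S) + 0 * (S - 2 * potential z + L z z)"
    by (rule tendsto_lowerbound)
       (use ineq eventually_at_right_less[of "0::real"] in \<open>auto simp: eventually_at_right_field intro!: exI[of _ 1]\<close>)
  then show ?thesis by simp
qed

text \<open>The potential is nowhere below its own average \<open>S\<close>.\<close>

lemma AE_potential_eq: "AE x in \<rho>. potential x = S"
proof -
  have "(LINT x|\<rho>. potential x - S) = 0"
    using integrable_potential by (simp add: S_eq)
  then have "AE x in \<rho>. potential x - S = 0"
    using integrable_potential S_le_potential by (subst (asm) integral_nonneg_eq_0_iff_AE) auto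
  then show ?thesis by simp
qed

lemma K_subset: "K \<subseteq> S2"
  by (auto simp: measure_supp_def)

lemma K_ball_pos:
  assumes "x \<in> K" "open U" "x \<in> U"
  shows "0 < measure \<rho> (U \<inter> S2)"
proof -
  have "openin (top_of_set S2) (U \<inter> S2)" using assms by (auto simp: openin_open)
  then show ?thesis using assms
    by (auto simp: measure_supp_def emeasure_eq_measure)
qed

text \<open>The complement of the support is a union of relatively open null sets, and countably many of them suffice.\<close>

lemma AE_K: "AE x in \<rho>. x \<in> K"
proof -
  define \<U> where "\<U> = {U. open U \<and> measure \<rho> (U \<inter> S2) = 0}"
  obtain \<V> where \<V>: "\<V> \<subseteq> \<U>" "countable \<V>" "\<Union>\<V> = \<Union>\<U>"
    using Lindelof[of \<U>] by (auto simp: \<U>_def)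
  have "(\<Union>U\<in>\<V>. U \<inter> S2) \<in> null_sets \<rho>"
    using \<V> by (intro null_sets_UN' ) (auto simp: \<U>_def null_sets_def emeasure_eq_measure intro!: borel_section)
  moreover have "S2 - K \<subseteq> (\<Union>U\<in>\<V>. U \<inter> S2)"
  proof
    fix x assume x: "x \<in> S2 - K"
    then obtain V where "openin (top_of_set S2) V" "x \<in> V" "\<not> 0 < emeasure \<rho> V"
      by (auto simp: measure_supp_def)
    then obtain U where "open U" "x \<in> U" "measure \<rho> (U \<inter> S2) = 0"
      by (auto simp: openin_open emeasure_eq_measure Int_commute zero_less_measure_iff)
    then have "x \<in> \<Union>\<V>" unfolding \<V>(3) by (auto simp: \<U>_def)
    then show "x \<in> (\<Union>U\<in>\<V>. U \<inter> S2)" using x by auto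
  qed
  ultimately show ?thesis
    by (intro AE_I'[of "\<Union>U\<in>\<V>. U \<inter> S2"]) auto
qed

lemma potential_on_K:
  assumes x: "x \<in> K"
  shows "potential x = S"
proof (rule ccontr)
  have xS: "x \<in> S2" using x K_subset by auto
  assume "potential x \<noteq> S"
  then have "S < potential x" using S_le_potential[OF xS] by simp
  define r where "r = (potential x - S) / (1 + \<tau>\<^sup>2)"
  have r: "0 < r" using \<open>S < potential x\<close> by (simp add: r_def add_pos_nonneg)
  have above: "S < potential y" if y: "y \<in> ball x r \<inter> S2" for y
  proof -
    have "potential x - potential y \<le> (1 + \<tau>\<^sup>2) / 2 * dist x y"
      using abs_le_D1[OF potential_Lipschitz[OF xS, of y]] y by simp
    also have "\<dots> \<le> (1 + \<tau>\<^sup>2) / 2 * r" using y by (intro mult_left_mono) auto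
    also have "\<dots> = (potential x - S) / 2" 
      using add_pos_nonneg[of 1 "\<tau>\<^sup>2"] by (simp add: r_def field_simps)
    finally show ?thesis using \<open>S < potential x\<close> by (simp add: field_simps)
  qed
  have "AE y in \<rho>. y \<notin> ball x r \<inter> S2"
    using AE_potential_eq by (rule eventually_mono) (use above in force)
  then have "ball x r \<inter> S2 \<in> null_sets \<rho>"
    by (subst (asm) AE_iff_null_sets[symmetric]) (auto intro!: borel_section)
  then show False using K_ball_pos[OF x open_ball, of x r] r
    by (auto simp: null_sets_def emeasure_eq_measure)
qed


section \<open>Positive semidefiniteness on the support\<close>

text \<open>Perturb \<open>\<rho>\<close> by the density \<open>1 + (\<psi> - m) / B\<close>, where subtracting the mean \<open>m\<close> of \<open>\<psi>\<close> preserves the total mass and the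
large constant \<open>B\<close> preserves positivity. The linear term vanishes, because the potential is constant almost
everywhere, so the quadratic term is nonnegative. Undoing the subtraction of the mean adds \<open>m\<^sup>2 S \<ge> 0\<close>.\<close>

lemma second_variation_nonneg:
  fixes \<psi> :: "real^3 \<Rightarrow> real"
  assumes [measurable]: "\<psi> \<in> borel_measurable borel" and b: "\<And>x. x \<in> S2 \<Longrightarrow> \<bar>\<psi> x\<bar> \<le> b"
  shows "0 \<le> (LINT x|\<rho>. \<psi> x * (LINT y|\<rho>. \<psi> y * L x y))"
proof -
  define T where "T x = (LINT y|\<rho>. \<psi> y * L x y)" for x
  have [measurable]: "T \<in> borel_measurable borel" unfolding T_def by measurable
  have b0: "0 \<le> b" using b[of "axis 1 1"] by (simp add: norm_Basis axis_in_Basis_iff)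
  define m where "m = (LINT x|\<rho>. \<psi> x)"
  have m: "\<bar>m\<bar> \<le> b" unfolding m_def by (rule abs_integral_le_bound) (use b in auto)
  define B where "B = 2 * b + 1"
  have B: "0 < B" using b0 by (simp add: B_def)
  have i\<psi>: "integrable \<rho> \<psi>" by (rule integrable_bounded[where B=b]) (use b in auto)
  have \<psi>L: "\<bar>\<psi> y * L x y\<bar> \<le> b" if "x \<in> S2" "y \<in> S2" for x y
    using mult_mono[OF b[OF that(2)] Lagrangian_bounds(3)[OF that, of \<tau>]] b0 by (simp add: abs_mult)
  have i\<psi>L: "integrable \<rho> (\<lambda>y. \<psi> y * L x y)" if "x \<in> S2" for x
    by (rule integrable_bounded[where B=b]) (use \<psi>L that in auto)
  have Tb: "\<bar>T x\<bar> \<le> b" if "x \<in> S2" for x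
    unfolding T_def by (rule abs_integral_le_bound) (use \<psi>L that in auto)
  have iT: "integrable \<rho> T" by (rule integrable_bounded[where B=b]) (use Tb in auto)
  have i\<psi>T: "integrable \<rho> (\<lambda>x. \<psi> x * T x)"
    by (rule integrable_bounded[where B="b * b"]) (use b Tb b0 in \<open>auto simp: abs_mult intro!: mult_mono\<close>)
  define g where "g x = 1 + (\<psi> x - m) / B" for x
  have [measurable]: "g \<in> borel_measurable borel" unfolding g_def by measurable
  have g0: "0 \<le> g x" if "x \<in> S2" for x
  proof -
    have "-B \<le> \<psi> x - m" using b[OF that] m by (auto simp: B_def)
    then have "- 1 \<le> (\<psi> x - m) / B" using B by (simp add: field_simps)
    then show ?thesis by (simp add: g_def)
  qed
  have ig: "integrable \<rho> g" unfolding g_def using i\<psi> by simp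
  have g1: "(LINT x|\<rho>. g x) = 1" unfolding g_def using i\<psi> by (simp add: m_def)
  have \<sigma>: "normalized_regular_borel (density \<rho> g)"
    by (rule density_competitor[OF normalized]) (use g0 ig g1 in auto)
  have int: "(LINT x|density \<rho> g. f x) = (LINT x|\<rho>. g x * f x)"
    if [measurable]: "f \<in> borel_measurable borel" for f :: "real^3 \<Rightarrow> real"
    using integral_density[of f \<rho> g] AE_I2[of \<rho> "\<lambda>x. 0 \<le> g x"] g0 by simp
  have Tg: "(LINT y|\<rho>. g y * L x y) = S + (T x - m * S) / B"
    if "x \<in> S2" "potential x = S" for x
  proof -
    have "(LINT y|\<rho>. g y * L x y) = (LINT y|\<rho>. L x y + (\<psi> y * L x y - m * L x y) / B)"
      by (simp add: g_def algebra_simps diff_divide_distrib)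
    also have "\<dots> = potential x + (T x - m * potential x) / B"
      using i\<psi>L[OF that(1)] integrable_L[OF that(1)] by (simp add: potential_def T_def)
    finally show ?thesis using that by simp
  qed
  \<comment> \<open>By Fubini and the symmetry of \<open>L\<close> the left side is the integral of \<open>\<psi>\<close> against the potential.\<close>
  have mT: "(LINT x|\<rho>. T x) = m * S"
  proof -
    have "integrable (\<rho> \<Otimes>\<^sub>M \<rho>) (\<lambda>(x, y). \<psi> y * L x y)"
    proof (rule integrableI_bounded_set[where A="space (\<rho> \<Otimes>\<^sub>M \<rho>)" and B=b])
      show "emeasure (\<rho> \<Otimes>\<^sub>M \<rho>) (space (\<rho> \<Otimes>\<^sub>M \<rho>)) < \<infinity>"
        by (simp only: space_pair_measure emeasure_pair_measure_Times sets.top)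
           (simp add: emeasure_eq_measure ennreal_mult_less_top flip: space_\<rho>)
    qed (use \<psi>L sets.top[of \<rho>] in \<open>auto simp: space_pair_measure intro!: AE_I2\<close>)
    from pair.Fubini_integral[OF this]
    have "(LINT x|\<rho>. T x) = (LINT y|\<rho>. LINT x|\<rho>. \<psi> y * L x y)" by (simp add: T_def)
    also have "\<dots> = (LINT y|\<rho>. \<psi> y * potential y)"
      by (simp add: potential_def Lagrangian_commute[of \<tau> _ y for y])
    also have "\<dots> = (LINT y|\<rho>. \<psi> y * S)"
      by (rule integral_cong_AE) (use AE_potential_eq in auto)
    finally show ?thesis by (simp add: m_def)
  qed
  have "action \<tau> (density \<rho> g) = (LINT x|density \<rho> g. LINT y|\<rho>. g y * L x y)"
    unfolding action_def by (rule Bochner_Integration.integral_cong) (auto intro!: int)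
  also have "\<dots> = (LINT x|\<rho>. g x * (LINT y|\<rho>. g y * L x y))"
    by (rule int) measurable
  also have "\<dots> = (LINT x|\<rho>. g x * (S + (T x - m * S) / B))"
    by (rule integral_cong_AE) (use AE_potential_eq AE_space Tg in \<open>auto elim!: eventually_elim2\<close>)
  also have "\<dots> = (LINT x|\<rho>. S * g x + (T x - m * S) / B 
                     + (\<psi> x * T x - m * T x - (\<psi> x - m) * (m * S)) / B\<^sup>2)"
    by (simp add: g_def algebra_simps power2_eq_square diff_divide_distrib add_divide_distrib)
  also have "\<dots> = S + ((LINT x|\<rho>. \<psi> x * T x) - m\<^sup>2 * S) / B\<^sup>2"
    using i\<psi> iT i\<psi>T ig by (simp add: g1 mT power2_eq_square flip: m_def)
  finally have "0 \<le> ((LINT x|\<rho>. \<psi> x * T x) - m\<^sup>2 * S) / B\<^sup>2"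
    using minimal[OF \<sigma>] by simp
  then have "m\<^sup>2 * S \<le> (LINT x|\<rho>. \<psi> x * T x)" using B by (simp add: zero_le_divide_iff)
  moreover have "0 \<le> m\<^sup>2 * S" using S_nonneg by simp
  ultimately show ?thesis by (simp add: T_def)
qed

text \<open>The density of \<open>\<rho>\<close> conditioned on a small ball around \<open>p\<close>: an approximation of the point mass at \<open>p\<close> among
the densities that \<open>second_variation_nonneg\<close> admits.\<close>

definition bump :: "real \<Rightarrow> real^3 \<Rightarrow> real^3 \<Rightarrow> real" where
  "bump r p x = indicator (ball p r) x / measure \<rho> (ball p r \<inter> S2)"

lemma measurable_bump [measurable]: "bump r p \<in> borel_measurable borel"
  unfolding bump_def by (intro borel_measurable_divide borel_measurable_indicator) auto

lemma bump_average:
  fixes f :: "real^3 \<Rightarrow> real"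
  assumes p: "p \<in> K" "0 < r" and [measurable]: "f \<in> borel_measurable borel"
    and B: "\<And>x. x \<in> S2 \<Longrightarrow> \<bar>f x\<bar> \<le> B"
    and f: "\<And>x. x \<in> S2 \<Longrightarrow> dist p x < r \<Longrightarrow> \<bar>f x - v\<bar> \<le> \<eta>"
  shows "integrable \<rho> (\<lambda>x. bump r p x * f x)"
    and "\<bar>(LINT x|\<rho>. bump r p x * f x) - v\<bar> \<le> \<eta>"
proof -
  define M where "M = measure \<rho> (ball p r \<inter> S2)"
  have M: "0 < M" unfolding M_def using p K_ball_pos[of p "ball p r"] by simp
  have bb: "0 \<le> bump r p x" "bump r p x \<le> 1 / M" for x
    using M by (auto simp: bump_def indicator_def simp flip: M_def)
  have ib: "integrable \<rho> (bump r p)"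
    by (rule integrable_bounded[where B="1/M"]) (use bb in auto)
  have "(LINT x|\<rho>. bump r p x) = (LINT x|\<rho>. indicator (ball p r \<inter> S2) x / M)"
    unfolding M_def by (rule Bochner_Integration.integral_cong) (auto simp: bump_def indicator_def)
  also have "\<dots> = 1"
    using M borel_section[of "ball p r"] by (simp add: M_def)
  finally have b1: "(LINT x|\<rho>. bump r p x) = 1" .
  show i1: "integrable \<rho> (\<lambda>x. bump r p x * f x)"
  proof (rule integrable_bounded[where B="1/M * B"])
    fix x assume x: "x \<in> S2"
    show "\<bar>bump r p x * f x\<bar> \<le> 1/M * B"
      unfolding abs_mult by (rule mult_mono) (use bb[of x] M B[OF x] in auto)
  qed measurable
  have "(LINT x|\<rho>. bump r p x * f x) - v = (LINT x|\<rho>. bump r p x * f x - bump r p x * v)"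
    using i1 ib b1 by simp
  also have "\<bar>\<dots>\<bar> \<le> (LINT x|\<rho>. \<bar>bump r p x * f x - bump r p x * v\<bar>)"
    by (rule integral_abs_bound)
  also have "\<dots> \<le> (LINT x|\<rho>. bump r p x * \<eta>)"
  proof (rule integral_mono)
    fix x assume "x \<in> space \<rho>"
    then have x: "x \<in> S2" by simp
    show "\<bar>bump r p x * f x - bump r p x * v\<bar> \<le> bump r p x * \<eta>"
    proof (cases "x \<in> ball p r")
      case True
      then show ?thesis using f[OF x] bb(1)[of x]
        by (simp add: abs_mult mult_left_mono flip: right_diff_distrib)
    qed (simp add: bump_def)
  qed (use i1 ib in auto)
  also have "\<dots> = \<eta>" using b1 by simp
  finally show "\<bar>(LINT x|\<rho>. bump r p x * f x) - v\<bar> \<le> \<eta>" .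
qed

lemma bump_L_average:
  assumes pq: "p \<in> K" "q \<in> K" and r: "0 < r"
  shows "integrable \<rho> (\<lambda>x. bump r p x * (LINT y|\<rho>. bump r q y * L x y))"
    and "x \<in> S2 \<Longrightarrow> integrable \<rho> (\<lambda>y. bump r q y * L x y)"
    and "\<bar>(LINT x|\<rho>. bump r p x * (LINT y|\<rho>. bump r q y * L x y)) - L p q\<bar> \<le> (1 + \<tau>\<^sup>2) * r"
proof -
  have S2: "p \<in> S2" "q \<in> S2" using pq K_subset by auto
  let ?F = "\<lambda>x. LINT y|\<rho>. bump r q y * L x y"
  have Lq: "\<bar>L x y - L x q\<bar> \<le> (1 + \<tau>\<^sup>2) / 2 * r" if "x \<in> S2" "y \<in> S2" "dist q y < r" for x y
  proof -
    have "\<bar>L x y - L x q\<bar> \<le> (1 + \<tau>\<^sup>2) / 2 * dist y q"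
      using Lagrangian_Lipschitz[OF that(2) S2(2) that(1), of \<tau>] by (simp add: Lagrangian_commute[of \<tau> x])
    also have "\<dots> \<le> (1 + \<tau>\<^sup>2) / 2 * r"
      using that by (intro mult_left_mono) (auto simp: dist_commute)
    finally show ?thesis .
  qed
  have F1: "\<bar>?F x - L x q\<bar> \<le> (1 + \<tau>\<^sup>2) / 2 * r" if "x \<in> S2" for x
    by (rule bump_average(2)[where B=1]) (use pq r Lq that Lagrangian_bounds(3) in auto)
  show "x \<in> S2 \<Longrightarrow> integrable \<rho> (\<lambda>y. bump r q y * L x y)"
    by (rule bump_average(1)[where B=1 and v="L x q" and \<eta>="(1 + \<tau>\<^sup>2) / 2 * r"])
       (use pq r Lq Lagrangian_bounds(3) in auto)
  have F2: "\<bar>?F x\<bar> \<le> 1 + (1 + \<tau>\<^sup>2) / 2 * r" if "x \<in> S2" for x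
    using F1[OF that] Lagrangian_bounds(3)[OF that S2(2), of \<tau>] by linarith
  have F3: "\<bar>?F x - L p q\<bar> \<le> (1 + \<tau>\<^sup>2) * r" if x: "x \<in> S2" "dist p x < r" for x
  proof -
    have "\<bar>L x q - L p q\<bar> \<le> (1 + \<tau>\<^sup>2) / 2 * dist x p"
      using Lagrangian_Lipschitz[OF x(1) S2] by simp
    also have "\<dots> \<le> (1 + \<tau>\<^sup>2) / 2 * r"
      using x by (intro mult_left_mono) (auto simp: dist_commute)
    finally have "\<bar>L x q - L p q\<bar> \<le> (1 + \<tau>\<^sup>2) / 2 * r" .
    moreover have "(1 + \<tau>\<^sup>2) * r = (1 + \<tau>\<^sup>2) / 2 * r + (1 + \<tau>\<^sup>2) / 2 * r" by (simp add: field_simps)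
    ultimately show ?thesis using F1[OF x(1)] by linarith
  qed
  show "integrable \<rho> (\<lambda>x. bump r p x * ?F x)"
    by (rule bump_average(1)[OF pq(1) r _ F2 F3]) measurable
  show "\<bar>(LINT x|\<rho>. bump r p x * ?F x) - L p q\<bar> \<le> (1 + \<tau>\<^sup>2) * r"
    by (rule bump_average(2)[OF pq(1) r _ F2 F3]) measurable
qed

text \<open>Every point of the support is a limit of such bumps, so the second variation can be tested with finite
combinations of point masses.\<close>

theorem Lagrangian_positive_semidefinite:
  fixes p :: "'i \<Rightarrow> real^3" and c :: "'i \<Rightarrow> real"
  assumes I: "finite I" and p: "\<And>i. i \<in> I \<Longrightarrow> p i \<in> K"
  shows "0 \<le> (\<Sum>i\<in>I. \<Sum>j\<in>I. c i * c j * L (p i) (p j))"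
proof -
  define A where "A r i j = (LINT x|\<rho>. bump r (p i) x * (LINT y|\<rho>. bump r (p j) y * L x y))" for r i j
  have "((\<lambda>r. \<Sum>i\<in>I. \<Sum>j\<in>I. c i * c j * A r i j) \<longlongrightarrow>
          (\<Sum>i\<in>I. \<Sum>j\<in>I. c i * c j * L (p i) (p j))) (at_right 0)"
  proof (intro tendsto_intros)
    fix i j assume ij: "i \<in> I" "j \<in> I"
    have "((\<lambda>r. A r i j - L (p i) (p j)) \<longlongrightarrow> 0) (at_right 0)"
    proof (rule Lim_null_comparison)
      show "\<forall>\<^sub>F r in at_right 0. norm (A r i j - L (p i) (p j)) \<le> (1 + \<tau>\<^sup>2) * r"
        using bump_L_average(3)[OF p[OF ij(1)] p[OF ij(2)]] eventually_at_right_less[of "0::real"]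
        by (auto simp: A_def elim!: eventually_mono)
      have "((\<lambda>r. (1 + \<tau>\<^sup>2) * r) \<longlongrightarrow> (1 + \<tau>\<^sup>2) * 0) (at_right 0)" by (intro tendsto_intros)
      then show "((\<lambda>r. (1 + \<tau>\<^sup>2) * r) \<longlongrightarrow> 0) (at_right 0)" by simp
    qed
    then show "((\<lambda>r. A r i j) \<longlongrightarrow> L (p i) (p j)) (at_right 0)" by (simp add: LIM_zero_iff)
  qed
  moreover have "0 \<le> (\<Sum>i\<in>I. \<Sum>j\<in>I. c i * c j * A r i j)" if r: "0 < r" for r
  proof -
    define \<psi> where "\<psi> x = (\<Sum>i\<in>I. c i * bump r (p i) x)" for x
    have [measurable]: "\<psi> \<in> borel_measurable borel" unfolding \<psi>_def by measurable
    have "\<bar>\<psi> x\<bar> \<le> (\<Sum>i\<in>I. \<bar>c i\<bar> * (1 / measure \<rho> (ball (p i) r \<inter> S2)))" for x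
      unfolding \<psi>_def
      by (rule order_trans[OF sum_abs])
         (auto intro!: sum_mono mult_left_mono divide_right_mono simp: abs_mult bump_def indicator_def)
    then have "0 \<le> (LINT x|\<rho>. \<psi> x * (LINT y|\<rho>. \<psi> y * L x y))"
      by (intro second_variation_nonneg) auto
    also have "\<dots> = (LINT x|\<rho>. (\<Sum>i\<in>I. \<Sum>j\<in>I. c i * c j * (bump r (p i) x * (LINT y|\<rho>. bump r (p j) y * L x y))))"
    proof (rule Bochner_Integration.integral_cong)
      fix x assume "x \<in> space \<rho>"
      then have x: "x \<in> S2" by simp
      have "(LINT y|\<rho>. \<psi> y * L x y) = (LINT y|\<rho>. (\<Sum>j\<in>I. c j * (bump r (p j) y * L x y)))"
        by (simp add: \<psi>_def sum_distrib_right mult.assoc)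
      also have "\<dots> = (\<Sum>j\<in>I. c j * (LINT y|\<rho>. bump r (p j) y * L x y))"
        using bump_L_average(2)[OF p p r x] by (simp add: Bochner_Integration.integral_sum)
      finally show "\<psi> x * (LINT y|\<rho>. \<psi> y * L x y) =
          (\<Sum>i\<in>I. \<Sum>j\<in>I. c i * c j * (bump r (p i) x * (LINT y|\<rho>. bump r (p j) y * L x y)))"
        by (simp add: \<psi>_def sum_product ac_simps)
    qed simp
    also have "\<dots> = (\<Sum>i\<in>I. \<Sum>j\<in>I. c i * c j * A r i j)"
      using bump_L_average(1)[OF p p r] by (simp add: A_def Bochner_Integration.integral_sum)
    finally show ?thesis .
  qed
  then have "\<forall>\<^sub>F r in at_right 0. 0 \<le> (\<Sum>i\<in>I. \<Sum>j\<in>I. c i * c j * A r i j)"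
    using eventually_at_right_less[of "0::real"] by (auto elim!: eventually_mono)
  ultimately show ?thesis by (rule tendsto_lowerbound) simp
qed

end

section \<open>Rigidity of nearby support points\<close>

text \<open>The monomials of degree at most two, with the constant as first entry. Together with the vector \<open>covector \<tau> y\<close> of the coefficients
of \<open>D(\<cdot>,y)\<close> they turn \<open>D\<close> into a scalar product.\<close>

definition veronese :: "real^3 \<Rightarrow> real \<times> (real^3) \<times> (real^3^3)" where
  "veronese x = (1, x, \<chi> i j. x $ i * x $ j)"

definition covector :: "real \<Rightarrow> real^3 \<Rightarrow> real \<times> (real^3) \<times> (real^3^3)" where
  "covector \<tau> y = ((2 - \<tau>\<^sup>2) / 4, (1/2) *\<^sub>R y, \<chi> i j. \<tau>\<^sup>2 / 4 * (y $ i * y $ j))"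

lemma D_fun_veronese: "D_fun \<tau> x y = veronese x \<bullet> covector \<tau> y"
proof -
  have "(x \<bullet> y)\<^sup>2 = (\<Sum>i\<in>UNIV. \<Sum>j\<in>UNIV. (x $ i * x $ j) * (y $ i * y $ j))"
    by (simp add: inner_vec_def power2_eq_square sum_product ac_simps)
  then have "\<tau>\<^sup>2 / 4 * (x \<bullet> y)\<^sup>2 = (\<chi> i j. x $ i * x $ j) \<bullet> (\<chi> i j. \<tau>\<^sup>2 / 4 * (y $ i * y $ j))"
    by (simp add: inner_vec_def sum_distrib_left ac_simps)
  then show ?thesis
    by (simp add: D_fun_eq_profile profile_def veronese_def covector_def add_divide_distrib diff_divide_distrib)
qed

lemma inj_veronese: "inj veronese"
  by (auto simp: veronese_def inj_def)

lemma D_fun_combination: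
  assumes "veronese a = (\<Sum>x\<in>T. c x *\<^sub>R veronese x)"
  shows "D_fun \<tau> a y = (\<Sum>x\<in>T. c x * D_fun \<tau> x y)"
  by (simp add: D_fun_veronese assms inner_sum_left)

context sphere_minimizer
begin

text \<open>The relation makes \<open>c\<close> a null vector of the matrix \<open>L(p\<^sub>i,p\<^sub>j) = D(p\<^sub>i,p\<^sub>j)\<close>. If the pairing \<open>b\<close> of \<open>c\<close> with the point mass
at \<open>y\<close> were nonzero, then the quadratic form at \<open>s c + \<delta>\<^sub>y\<close> would be \<open>L(y,y) + 2 s b\<close>, which is negative for a suitable \<open>s\<close>.
The index type \<open>'i option\<close> adds \<open>y\<close> to the points even if it is one of them.\<close>

lemma Lagrangian_null_combination:
  fixes p :: "'i \<Rightarrow> real^3" and c :: "'i \<Rightarrow> real"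
  assumes I: "finite I" and p: "\<And>i. i \<in> I \<Longrightarrow> p i \<in> K"
    and D: "\<And>i j. i \<in> I \<Longrightarrow> j \<in> I \<Longrightarrow> 0 \<le> D (p i) (p j)"
    and null: "(\<Sum>i\<in>I. c i *\<^sub>R veronese (p i)) = 0" and y: "y \<in> K"
  shows "(\<Sum>i\<in>I. c i * L (p i) y) = 0"
proof (rule ccontr)
  define b where "b = (\<Sum>i\<in>I. c i * L (p i) y)"
  assume "(\<Sum>i\<in>I. c i * L (p i) y) \<noteq> 0"
  then have b: "b \<noteq> 0" by (simp add: b_def)
  have "(\<Sum>i\<in>I. \<Sum>j\<in>I. c i * c j * L (p i) (p j)) = (\<Sum>j\<in>I. \<Sum>i\<in>I. c j * (c i * D (p i) (p j)))"
    by (subst sum.swap) (intro sum.cong refl, simp add: Lagrangian_def D)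
  also have "\<dots> = (\<Sum>j\<in>I. c j * ((\<Sum>i\<in>I. c i *\<^sub>R veronese (p i)) \<bullet> covector \<tau> (p j)))"
    by (simp add: D_fun_veronese inner_sum_left sum_distrib_left)
  finally have zero: "(\<Sum>i\<in>I. \<Sum>j\<in>I. c i * c j * L (p i) (p j)) = 0" using null by simp
  define s where "s = - (L y y + 1) / (2 * b)"
  define c' where "c' = case_option 1 (\<lambda>i. s * c i)"
  define p' where "p' = case_option y p"
  have "0 \<le> (\<Sum>i\<in>insert None (Some ` I). \<Sum>j\<in>insert None (Some ` I). c' i * c' j * L (p' i) (p' j))"
    by (rule Lagrangian_positive_semidefinite) (use I p y in \<open>auto simp: p'_def\<close>)
  also have "\<dots> = L y y + (\<Sum>j\<in>I. s * (c j * L y (p j))) + 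
      ((\<Sum>i\<in>I. s * (c i * L (p i) y)) + (\<Sum>i\<in>I. \<Sum>j\<in>I. (s * s) * (c i * c j * L (p i) (p j))))"
    using I by (simp add: sum.reindex c'_def p'_def sum.distrib ac_simps)
  also have "\<dots> = L y y + s * b + (s * b + (s * s) * (\<Sum>i\<in>I. \<Sum>j\<in>I. c i * c j * L (p i) (p j)))"
    by (simp add: b_def Lagrangian_commute[of \<tau> y "p j" for j] flip: sum_distrib_left)
  also have "\<dots> = L y y + 2 * b * s" using zero by simp
  also have "\<dots> = - 1" using b by (simp add: s_def)
  finally show False by simp
qed

lemma Lagrangian_combination:
  assumes T: "finite T" "T \<subseteq> K" and a: "a \<in> K"
    and D: "\<And>x z. x \<in> insert a T \<Longrightarrow> z \<in> insert a T \<Longrightarrow> 0 \<le> D x z"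
    and c: "veronese a = (\<Sum>x\<in>T. c x *\<^sub>R veronese x)" and y: "y \<in> K"
  shows "L a y = (\<Sum>x\<in>T. c x * L x y)"
proof -
  define c' where "c' = case_option (- 1) c"
  define p' where "p' = case_option a id"
  have "(\<Sum>i\<in>insert None (Some ` T). c' i * L (p' i) y) = 0"
    by (rule Lagrangian_null_combination)
       (use T a D c y in \<open>auto simp: p'_def c'_def sum.reindex\<close>)
  then show ?thesis using T by (simp add: p'_def c'_def sum.reindex)
qed

lemma span_combination:
  assumes "veronese a \<in> span (veronese ` A)"
  obtains T c where "finite T" "T \<subseteq> A" "veronese a = (\<Sum>x\<in>T. c x *\<^sub>R veronese x)"
proof -
  obtain t r where t: "finite t" "t \<subseteq> veronese ` A" "veronese a = (\<Sum>v\<in>t. r v *\<^sub>R v)"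
    using assms unfolding span_explicit by blast
  obtain T where T: "T \<subseteq> A" "finite T" "t = veronese ` T"
    using finite_subset_image[OF t(1,2)] by blast
  have "veronese a = (\<Sum>x\<in>T. r (veronese x) *\<^sub>R veronese x)"
    unfolding t(3) T(3) by (rule sum.reindex_cong[OF inj_on_subset[OF inj_veronese]]) auto
  then show ?thesis using T that[of T "r \<circ> veronese"] by simp
qed

text \<open>On \<open>A\<close> the function \<open>L(\<cdot>,y)\<close> agrees with the polynomial \<open>D(\<cdot>,y)\<close> in the first case and with \<open>0\<close> in the second.
By \<open>Lagrangian_combination\<close> the agreement persists at \<open>a\<close>, and \<open>L = max 0 D\<close> reveals the sign of \<open>D\<close> there.\<close>

lemma sign_extends:
  assumes A: "A \<subseteq> K" and a: "a \<in> K" and span: "veronese a \<in> span (veronese ` A)"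
    and D: "\<And>x z. x \<in> insert a A \<Longrightarrow> z \<in> insert a A \<Longrightarrow> 0 \<le> D x z" and y: "y \<in> K"
  shows "(\<forall>x\<in>A. 0 \<le> D x y) \<Longrightarrow> 0 \<le> D a y"
    and "(\<forall>x\<in>A. D x y \<le> 0) \<Longrightarrow> D a y \<le> 0"
proof -
  obtain T c where T: "finite T" "T \<subseteq> A" and c: "veronese a = (\<Sum>x\<in>T. c x *\<^sub>R veronese x)"
    using span_combination[OF span] .
  have La: "L a y = (\<Sum>x\<in>T. c x * L x y)"
    by (rule Lagrangian_combination[OF T(1) _ a _ c y]) (use T A D in blast)+
  show "0 \<le> D a y" if "\<forall>x\<in>A. 0 \<le> D x y"
  proof -
    have "L a y = (\<Sum>x\<in>T. c x * D x y)"
      unfolding La by (rule sum.cong) (use that T in \<open>auto simp: Lagrangian_def\<close>)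
    also have "\<dots> = D a y" using D_fun_combination[OF c] by simp
    finally show ?thesis by (simp add: Lagrangian_def max_def split: if_splits)
  qed
  show "D a y \<le> 0" if "\<forall>x\<in>A. D x y \<le> 0"
  proof -
    have "L a y = 0"
      unfolding La by (rule sum.neutral) (use that T in \<open>auto simp: Lagrangian_def\<close>)
    then show ?thesis by (simp add: Lagrangian_def max_def split: if_splits)
  qed
qed

lemma zero_extends:
  assumes "veronese a \<in> span (veronese ` A)" "\<forall>x\<in>A. D x y = 0"
  shows "D a y = 0"
proof -
  obtain T c where T: "finite T" "T \<subseteq> A" and c: "veronese a = (\<Sum>x\<in>T. c x *\<^sub>R veronese x)"
    using span_combination[OF assms(1)] .
  have "(\<Sum>x\<in>T. c x * D x y) = 0"
    by (rule sum.neutral) (use T assms(2) in auto)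
  then show ?thesis using D_fun_combination[OF c, of \<tau> y] by simp
qed

end

text \<open>Let \<open>A\<close> be an infinite subset of \<open>E\<close> whose Veronese vectors span a space of least possible dimension. An infinite part of
\<open>A\<close> cannot span a smaller space, so it spans the same one. Compactness of the sphere provides an accumulation point.\<close>

lemma minimal_span_sequence:
  fixes E :: "(real^3) set"
  assumes "infinite E" "E \<subseteq> S2" "0 < \<delta>"
  obtains X :: "nat \<Rightarrow> real^3" and x where "inj X" "range X \<subseteq> E" "X \<longlonglongrightarrow> x" "x \<in> S2"
    "\<And>n. X n \<noteq> x" "\<And>n. dist (X n) x < \<delta>"
    "\<And>N k. infinite N \<Longrightarrow> veronese (X k) \<in> span (veronese ` X ` N)"
proof -
  obtain A where A: "infinite A" "A \<subseteq> E"
    and min: "\<And>A'. infinite A' \<Longrightarrow> A' \<subseteq> E \<Longrightarrow> dim (veronese ` A) \<le> dim (veronese ` A')"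
    using ex_has_least_nat[of "\<lambda>A. infinite A \<and> A \<subseteq> E" E "\<lambda>A. dim (veronese ` A)"] assms by auto
  obtain x where x: "x \<in> S2" "x islimpt A"
    using compact_sphere[of "0::real^3" 1] A assms(2) unfolding compact_eq_Bolzano_Weierstrass
    by (metis order_trans)
  obtain Y where Y: "\<And>n. Y n \<in> A - {x}" "inj Y" "Y \<longlonglongrightarrow> x"
    using x(2) unfolding limpt_sequential_inj by auto
  obtain m where m: "\<And>n. n \<ge> m \<Longrightarrow> dist (Y n) x < \<delta>"
    using Y(3) assms(3) unfolding lim_sequentially by blast
  define X where "X n = Y (n + m)" for n
  have "veronese (X k) \<in> span (veronese ` X ` N)" if N: "infinite N" for N k
  proof -
    have "inj X" using Y(2) unfolding X_def inj_def by (metis add_right_cancel)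
    then have "infinite (X ` N)" using N by (meson finite_imageD inj_on_subset subset_UNIV)
    moreover have XA: "X ` N \<subseteq> A" using Y(1) by (auto simp: X_def)
    ultimately have "dim (veronese ` A) \<le> dim (veronese ` X ` N)" using A by (intro min) auto
    moreover have "span (veronese ` X ` N) \<subseteq> span (veronese ` A)"
      using XA by (intro span_mono image_mono)
    ultimately have "span (veronese ` X ` N) = span (veronese ` A)"
      by (intro subspace_dim_equal) (auto simp: dim_span)
    then show ?thesis using Y(1)[of "k + m"] by (auto simp: X_def intro: span_base)
  qed
  moreover have "inj X" using Y(2) unfolding X_def inj_def by (metis add_right_cancel)
  moreover have "range X \<subseteq> E" using Y(1) A(2) by (auto simp: X_def)
  moreover have "X \<longlonglongrightarrow> x" unfolding X_def using Y(3) by (rule LIMSEQ_ignore_initial_segment)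
  moreover have "X n \<noteq> x" "dist (X n) x < \<delta>" for n using Y(1) m by (auto simp: X_def)
  ultimately show ?thesis using x(1) that by blast
qed

section \<open>First variation of the potential\<close>

text \<open>The one-sided derivative of \<open>L(\<cdot>,y)\<close> at \<open>x\<close> in the tangent direction \<open>u\<close>. It depends only positively homogeneously, not
linearly, on \<open>u\<close> at the zeros of \<open>D(\<cdot>,y)\<close>, where \<open>L(\<cdot>,y)\<close> may have a kink.\<close>

definition dLagrangian :: "real \<Rightarrow> real^3 \<Rightarrow> real^3 \<Rightarrow> real^3 \<Rightarrow> real" where
  "dLagrangian \<tau> x u y =
     (if D_fun \<tau> x y < 0 then 0
      else if D_fun \<tau> x y = 0 then max 0 (profile' \<tau> (x \<bullet> y) * (u \<bullet> y))
      else profile' \<tau> (x \<bullet> y) * (u \<bullet> y))"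

definition great_circle :: "real^3 \<Rightarrow> real^3 \<Rightarrow> real \<Rightarrow> real^3" where
  "great_circle x u s = cos s *\<^sub>R x + sin s *\<^sub>R u"

lemma great_circle_S2:
  assumes "x \<in> S2" "norm u = 1" "x \<bullet> u = 0"
  shows "great_circle x u s \<in> S2"
proof -
  have "x \<bullet> x = 1" "u \<bullet> u = 1" using assms by (auto simp: dot_square_norm)
  then have "great_circle x u s \<bullet> great_circle x u s = (cos s)\<^sup>2 + (sin s)\<^sup>2"
    using assms by (simp add: great_circle_def inner_simps inner_commute power2_eq_square)
  then show ?thesis by (simp add: norm_eq_sqrt_inner)
qed

lemma dist_great_circle:
  assumes "x \<in> S2" "norm u = 1" "0 \<le> s"
  shows "dist (great_circle x u s) x \<le> 2 * s"
proof -
  have half: "\<bar>sin (s/2)\<bar> \<le> s/2" "\<bar>sin (s/2)\<bar> \<le> 1" "\<bar>sin s\<bar> \<le> s"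
    using abs_sin_x_le_abs_x[of "s/2"] abs_sin_x_le_abs_x[of s] assms by auto
  have "\<bar>cos s - 1\<bar> = 2 * (\<bar>sin (s/2)\<bar> * \<bar>sin (s/2)\<bar>)"
    using cos_double_sin[of "s/2"] by (simp add: power2_eq_square abs_mult)
  also have "\<dots> \<le> 2 * (s/2 * 1)" using half assms by (intro mult_left_mono mult_mono) auto
  finally have "\<bar>cos s - 1\<bar> \<le> s" by simp
  moreover have "great_circle x u s - x = (cos s - 1) *\<^sub>R x + sin s *\<^sub>R u"
    by (simp add: great_circle_def algebra_simps)
  then have "dist (great_circle x u s) x \<le> \<bar>cos s - 1\<bar> + \<bar>sin s\<bar>"
    using norm_triangle_ineq[of "(cos s - 1) *\<^sub>R x" "sin s *\<^sub>R u"] assms by (simp add: dist_norm)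
  ultimately show ?thesis using half by linarith
qed

lemma D_fun_great_circle_deriv:
  "((\<lambda>s. D_fun \<tau> (great_circle x u s) y) has_real_derivative profile' \<tau> (x \<bullet> y) * (u \<bullet> y)) (at 0)"
  unfolding D_fun_eq_profile profile_def profile'_def great_circle_def inner_add_left inner_scaleR_left
  by (auto intro!: derivative_eq_intros simp: field_simps)

lemma Lagrangian_right_derivative:
  defines "h \<equiv> \<lambda>n. inverse (real (Suc n))"
  shows "(\<lambda>n. (Lagrangian \<tau> (great_circle x u (h n)) y - Lagrangian \<tau> x y) / h n)
           \<longlonglongrightarrow> dLagrangian \<tau> x u y"
proof -
  define f where "f s = D_fun \<tau> (great_circle x u s) y" for s
  define d where "d = profile' \<tau> (x \<bullet> y) * (u \<bullet> y)"
  have f0: "f 0 = D_fun \<tau> x y" by (simp add: f_def great_circle_def)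
  have h: "0 < h n" for n by (simp add: h_def)
  have h0: "filterlim h (at 0) sequentially"
    using LIMSEQ_inverse_real_of_nat h by (auto simp: filterlim_at h_def)
  have der: "(f has_real_derivative d) (at 0)"
    unfolding f_def d_def by (rule D_fun_great_circle_deriv)
  have quot: "(\<lambda>n. (f (h n) - f 0) / h n) \<longlonglongrightarrow> d"
    using filterlim_compose[OF der[unfolded DERIV_def] h0] by simp
  have fh: "(\<lambda>n. f (h n)) \<longlonglongrightarrow> f 0"
    using filterlim_compose[OF DERIV_isCont[OF der, unfolded isCont_def] h0] .
  have L: "Lagrangian \<tau> (great_circle x u (h n)) y - Lagrangian \<tau> x y = max 0 (f (h n)) - max 0 (f 0)" for n
    by (simp add: Lagrangian_def f_def great_circle_def)
  consider "f 0 < 0" | "f 0 = 0" | "0 < f 0" by linarith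
  then show ?thesis
  proof cases
    case 1
    then have "\<forall>\<^sub>F n in sequentially. (Lagrangian \<tau> (great_circle x u (h n)) y - Lagrangian \<tau> x y) / h n = 0"
      using order_tendstoD(2)[OF fh 1] by (auto simp: L elim!: eventually_mono)
    then show ?thesis using 1 f0 by (simp add: dLagrangian_def tendsto_eventually)
  next
    case 2
    have "(\<lambda>n. max 0 ((f (h n) - f 0) / h n)) \<longlonglongrightarrow> max 0 d"
      using quot by (intro tendsto_max) auto
    moreover have "max 0 ((f (h n) - f 0) / h n) = (Lagrangian \<tau> (great_circle x u (h n)) y - Lagrangian \<tau> x y) / h n" for n
      using 2 h[of n] by (auto simp: L max_def field_simps)
    ultimately show ?thesis using 2 f0 by (simp add: dLagrangian_def d_def)
  next
    case 3
    then have "\<forall>\<^sub>F n in sequentially. (f (h n) - f 0) / h n = (Lagrangian \<tau> (great_circle x u (h n)) y - Lagrangian \<tau> x y) / h n"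
      using order_tendstoD(1)[OF fh 3] by (auto simp: L elim!: eventually_mono)
    then show ?thesis using Lim_transform_eventually[OF quot] 3 f0 by (simp add: dLagrangian_def d_def)
  qed
qed

lemma abs_profile'_le: "\<bar>t\<bar> \<le> 1 \<Longrightarrow> \<bar>profile' \<tau> t\<bar> \<le> (1 + \<tau>\<^sup>2) / 2"
  using mult_left_mono[of "\<bar>t\<bar>" 1 "\<tau>\<^sup>2"] abs_mult[of "\<tau>\<^sup>2" t] by (auto simp: profile'_def)

lemma abs_dLagrangian_le:
  assumes "x \<in> S2" "y \<in> S2" "norm u = 1"
  shows "\<bar>dLagrangian \<tau> x u y\<bar> \<le> (1 + \<tau>\<^sup>2) / 2"
proof -
  have "\<bar>profile' \<tau> (x \<bullet> y)\<bar> * \<bar>u \<bullet> y\<bar> \<le> (1 + \<tau>\<^sup>2) / 2 * 1"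
    using abs_profile'_le[OF inner_sphere_bound] inner_sphere_bound[of u y] assms
    by (intro mult_mono) auto
  then have "\<bar>profile' \<tau> (x \<bullet> y) * (u \<bullet> y)\<bar> \<le> (1 + \<tau>\<^sup>2) / 2" by (simp add: abs_mult)
  moreover have "0 \<le> (1 + \<tau>\<^sup>2) / 2" by simp
  ultimately show ?thesis unfolding dLagrangian_def by (auto simp del: zero_le_divide_iff)
qed

lemma measurable_dLagrangian [measurable]: "dLagrangian \<tau> x u \<in> borel_measurable borel"
  unfolding dLagrangian_def D_fun_def profile'_def by measurable

context sphere_minimizer
begin

text \<open>The potential is minimal at \<open>x\<close>, so its difference quotients along a great circle are nonnegative; they
converge by dominated convergence, because \<open>L\<close> is Lipschitz continuous.\<close>

lemma directional_derivative_nonneg: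
  assumes x: "x \<in> S2" "potential x = S" and u: "norm u = 1" "x \<bullet> u = 0"
  shows "0 \<le> (LINT y|\<rho>. dLagrangian \<tau> x u y)"
proof -
  define h where "h n = inverse (real (Suc n))" for n
  have h: "0 < h n" for n by (simp add: h_def)
  let ?c = "great_circle x u"
  let ?q = "\<lambda>n y. (L (?c (h n)) y - L x y) / h n"
  have c: "?c s \<in> S2" for s using great_circle_S2 x(1) u by blast
  have "(\<lambda>n. LINT y|\<rho>. ?q n y) \<longlonglongrightarrow> (LINT y|\<rho>. dLagrangian \<tau> x u y)"
  proof (rule integral_dominated_convergence[where w="\<lambda>_. 1 + \<tau>\<^sup>2"])
    show "AE y in \<rho>. (\<lambda>n. ?q n y) \<longlonglongrightarrow> dLagrangian \<tau> x u y"
      using Lagrangian_right_derivative unfolding h_def by (intro AE_I2) blast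
    fix n
    have "\<bar>?q n y\<bar> \<le> 1 + \<tau>\<^sup>2" if y: "y \<in> S2" for y
    proof -
      have "\<bar>L (?c (h n)) y - L x y\<bar> \<le> (1 + \<tau>\<^sup>2) / 2 * dist (?c (h n)) x"
        by (rule Lagrangian_Lipschitz[OF c x(1) y])
      also have "\<dots> \<le> (1 + \<tau>\<^sup>2) / 2 * (2 * h n)"
        using dist_great_circle[OF x(1) u(1), of "h n"] h[of n] by (intro mult_left_mono) auto
      finally have "\<bar>L (?c (h n)) y - L x y\<bar> \<le> (1 + \<tau>\<^sup>2) * h n" by simp
      then show ?thesis
        unfolding abs_div_pos[OF h, symmetric] by (simp only: pos_divide_le_eq[OF h])
    qed
    then show "AE y in \<rho>. norm (?q n y) \<le> 1 + \<tau>\<^sup>2" by (intro AE_I2) simp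
  qed auto
  moreover have "0 \<le> (LINT y|\<rho>. ?q n y)" for n
  proof -
    have "(LINT y|\<rho>. ?q n y) = (potential (?c (h n)) - potential x) / h n"
      using integrable_L[OF c] integrable_L[OF x(1)] by (simp add: potential_def)
    then show ?thesis using S_le_potential[OF c] x(2) h[of n] by simp
  qed
  ultimately show ?thesis by (intro tendsto_lowerbound[of _ _ sequentially 0]) auto
qed

end

section \<open>Concavity along great circles inside the light cone\<close>

lemma D_fun_pos_imp:
  assumes "x \<in> S2" "y \<in> S2" "0 < D_fun \<tau> x y" "\<tau> \<noteq> 0"
  shows "1 - 2 / \<tau>\<^sup>2 < x \<bullet> y"
proof -
  have "0 < (1 + x \<bullet> y) * (2 - \<tau>\<^sup>2 * (1 - x \<bullet> y))" using assms(3) by (simp add: D_fun_def)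
  moreover have "0 \<le> 1 + x \<bullet> y" using inner_sphere_bound[OF assms(1,2)] by linarith
  ultimately have "0 < 2 - \<tau>\<^sup>2 * (1 - x \<bullet> y)" by (simp add: zero_less_mult_iff)
  then show ?thesis using assms(4) by (simp add: field_simps)
qed

lemma D_fun_zero_imp:
  assumes "D_fun \<tau> x y = 0" "\<tau> \<noteq> 0"
  shows "x \<bullet> y = - 1 \<or> x \<bullet> y = 1 - 2 / \<tau>\<^sup>2"
proof -
  have "1 + x \<bullet> y = 0 \<or> 2 - \<tau>\<^sup>2 * (1 - x \<bullet> y) = 0" using assms by (simp add: D_fun_def)
  then show ?thesis using assms by (auto simp: field_simps)
qed

lemma D_fun_nonneg:
  assumes "x \<in> S2" "y \<in> S2" "\<tau> \<noteq> 0" "1 - 2 / \<tau>\<^sup>2 \<le> x \<bullet> y"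
  shows "0 \<le> D_fun \<tau> x y"
proof -
  have "0 \<le> 1 + x \<bullet> y" using inner_sphere_bound[OF assms(1,2)] by linarith
  moreover have "0 \<le> 2 - \<tau>\<^sup>2 * (1 - x \<bullet> y)" using assms by (simp add: field_simps)
  ultimately show ?thesis by (simp add: D_fun_def)
qed

lemma inner_eq_dist:
  fixes x y :: "real^3"
  assumes "x \<in> S2" "y \<in> S2"
  shows "x \<bullet> y = 1 - (dist x y)\<^sup>2 / 2"
  using assms dot_norm_neg[of x y] by (simp add: dist_norm diff_divide_distrib)

lemma D_fun_nonneg_near:
  assumes "x \<in> S2" "y \<in> S2" "0 < \<tau>" "dist x y \<le> 2 / \<tau>"
  shows "0 \<le> D_fun \<tau> x y"
proof (rule D_fun_nonneg[OF assms(1,2)])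
  have "(dist x y)\<^sup>2 \<le> (2 / \<tau>)\<^sup>2" using assms by (intro power_mono) auto
  then show "1 - 2 / \<tau>\<^sup>2 \<le> x \<bullet> y"
    unfolding inner_eq_dist[OF assms(1,2)] by (simp add: power_divide)
qed (use assms in auto)

text \<open>The orthogonal projection of \<open>z\<close> to the tangent plane of the sphere at \<open>x\<close>.\<close>

definition tangent :: "real^3 \<Rightarrow> real^3 \<Rightarrow> real^3" where
  "tangent x z = z - (z \<bullet> x) *\<^sub>R x"

lemma tangent_orthogonal: "x \<in> S2 \<Longrightarrow> x \<bullet> tangent x z = 0"
  by (simp add: tangent_def inner_diff_right inner_commute[of x z] dot_square_norm)

lemma norm_tangent:
  assumes "x \<in> S2" "z \<in> S2"
  shows "(norm (tangent x z))\<^sup>2 = 1 - (x \<bullet> z)\<^sup>2"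
proof -
  have "x \<bullet> x = 1" "z \<bullet> z = 1" using assms by (auto simp: dot_square_norm)
  then show ?thesis
    unfolding power2_norm_eq_inner tangent_def
    by (simp add: inner_diff_left inner_diff_right inner_commute[of z x] power2_eq_square)
qed

text \<open>With \<open>q = \<tau>\<^sup>2\<close> and \<open>t = x \<bullet> y\<close>, the second derivative of \<open>D(\<cdot>,y)\<close> along a great circle through \<open>x\<close> is at most
\<open>(q - t - 2 q t\<^sup>2) / 2\<close>, the value for the great circle that passes through \<open>y\<close>. In the range \<open>t \<ge> 1 - 2 / q\<close> this is
largest at \<open>t = 1 - 2 / q\<close>, where it equals \<open>- (q - 1) (q - 6) / (2 q)\<close>; this is where the bound \<open>\<surd>6\<close> comes from. The
last summand of the estimate absorbs the terms of higher order in the distance.\<close>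

lemma D_fun_concave:
  assumes S2: "x \<in> S2" "y \<in> S2" "z \<in> S2" and \<tau>: "sqrt 6 < \<tau>"
    and xy: "1 - 2 / \<tau>\<^sup>2 \<le> x \<bullet> y" and r: "dist x z \<le> 1"
  shows "D_fun \<tau> z y - D_fun \<tau> x y \<le> profile' \<tau> (x \<bullet> y) * (tangent x z \<bullet> y)
           - (dist x z)\<^sup>2 / 4 * ((\<tau>\<^sup>2 - 1) * (\<tau>\<^sup>2 - 6) / \<tau>\<^sup>2 - 2 * \<tau>\<^sup>2 * dist x z)"
proof -
  define t where "t = x \<bullet> y"
  define r where "r = dist x z"
  define a where "a = tangent x z \<bullet> y"
  define q where "q = \<tau>\<^sup>2"
  have q6: "6 < q" using power_strict_mono[OF \<tau>, of 2] by (simp add: q_def)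
  have t01: "1 - 2 / q \<le> t" "0 \<le> t" "t \<le> 1"
  proof -
    have "2 / q \<le> 1" using q6 by simp
    moreover show "1 - 2 / q \<le> t" using xy by (simp add: t_def q_def)
    ultimately show "0 \<le> t" by linarith
    show "t \<le> 1" using inner_sphere_bound[OF S2(1,2)] by (simp add: t_def)
  qed
  have r01: "0 \<le> r" "r \<le> 1" using assms(6) by (auto simp: r_def)
  have zx: "z \<bullet> x = 1 - r\<^sup>2 / 2" using inner_eq_dist[OF S2(1,3)] by (simp add: r_def inner_commute)
  have zy: "z \<bullet> y = t + (a - r\<^sup>2 / 2 * t)"
    unfolding a_def tangent_def inner_diff_left zx by (simp add: t_def algebra_simps)
  have w: "(norm (tangent x z))\<^sup>2 \<le> r\<^sup>2"
    unfolding norm_tangent[OF S2(1,3)] inner_commute[of x z] zx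
    using r01 by (auto simp: power2_eq_square field_simps)
  have a2: "a\<^sup>2 \<le> r\<^sup>2 * (1 - t\<^sup>2)"
  proof -
    have "a = tangent x z \<bullet> tangent x y"
      using tangent_orthogonal[OF S2(1), of z]
      by (simp add: a_def tangent_def[of x y] inner_diff_right inner_commute)
    then have "a\<^sup>2 \<le> (tangent x z \<bullet> tangent x z) * (tangent x y \<bullet> tangent x y)"
      using Cauchy_Schwarz_ineq by simp
    also have "\<dots> = (norm (tangent x z))\<^sup>2 * (1 - t\<^sup>2)"
      using norm_tangent[OF S2(1,2)] by (simp add: t_def flip: power2_norm_eq_inner)
    also have "\<dots> \<le> r\<^sup>2 * (1 - t\<^sup>2)"
      using w t01 by (intro mult_right_mono) (auto simp: abs_square_le_1)
    finally show ?thesis .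
  qed
  have ar: "\<bar>a\<bar> \<le> r"
  proof -
    have "a\<^sup>2 \<le> r\<^sup>2" using a2 mult_left_mono[of "1 - t\<^sup>2" 1 "r\<^sup>2"] by simp
    then show ?thesis using r01 abs_le_square_iff[of a r] by simp
  qed
  have dev: "(a - r\<^sup>2 / 2 * t)\<^sup>2 \<le> r\<^sup>2 * (1 - t\<^sup>2) + 2 * r * r\<^sup>2"
  proof -
    have "- a * t \<le> r * 1"
      using mult_mono[OF ar, of t 1] t01 r01 abs_ge_minus_self[of "a * t"] by (simp add: abs_mult)
    then have "(- a * t) * r\<^sup>2 \<le> r * r\<^sup>2" by (intro mult_right_mono) auto
    moreover have "r * r\<^sup>2 * (r * t\<^sup>2 / 4) \<le> r * r\<^sup>2 * 1"
      using r01 t01 mult_mono[of r 1 "t\<^sup>2" 1] by (intro mult_left_mono) (auto simp: abs_square_le_1)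
    moreover have "(a - r\<^sup>2 / 2 * t)\<^sup>2 = a\<^sup>2 + (- a * t) * r\<^sup>2 + r * r\<^sup>2 * (r * t\<^sup>2 / 4)"
      by (simp add: power2_eq_square field_simps)
    ultimately show ?thesis using a2 by linarith
  qed
  have drop: "q - t - 2 * q * t\<^sup>2 \<le> - ((q - 1) * (q - 6) / q)"
  proof -
    have "(1 - 2 / q)\<^sup>2 \<le> t\<^sup>2" using t01 q6 by (intro power_mono) auto
    then have "2 * q * (1 - 2 / q)\<^sup>2 \<le> 2 * q * t\<^sup>2" using q6 by (intro mult_left_mono) auto
    moreover have "q - (1 - 2 / q) - 2 * q * (1 - 2 / q)\<^sup>2 = - ((q - 1) * (q - 6) / q)"
      using q6 by (simp add: power2_eq_square field_simps)
    ultimately show ?thesis using t01 by linarith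
  qed
  have "D_fun \<tau> z y - D_fun \<tau> x y = (1 + q * t) / 2 * (a - r\<^sup>2 / 2 * t) + q / 4 * (a - r\<^sup>2 / 2 * t)\<^sup>2"
    unfolding D_fun_eq_profile zy profile_def t_def[symmetric] q_def[symmetric]
    by (simp add: power2_eq_square field_simps)
  also have "\<dots> \<le> (1 + q * t) / 2 * (a - r\<^sup>2 / 2 * t) + q / 4 * (r\<^sup>2 * (1 - t\<^sup>2) + 2 * r * r\<^sup>2)"
    using dev q6 by (intro add_left_mono mult_left_mono) auto
  also have "\<dots> = (1 + q * t) / 2 * a + r\<^sup>2 / 4 * (q - t - 2 * q * t\<^sup>2 + 2 * q * r)"
    by (simp add: power2_eq_square field_simps)
  also have "\<dots> \<le> (1 + q * t) / 2 * a + r\<^sup>2 / 4 * (- ((q - 1) * (q - 6) / q) + 2 * q * r)"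
    using drop by (intro add_left_mono mult_left_mono) auto
  finally show ?thesis 
    by (simp add: profile'_def t_def q_def r_def a_def algebra_simps)
qed

section \<open>Finiteness of the support\<close>

lemma tendsto_D_fun_left:
  assumes "X \<longlonglongrightarrow> x"
  shows "(\<lambda>k. D_fun \<tau> (X k) y) \<longlonglongrightarrow> D_fun \<tau> x y"
  unfolding D_fun_def by (intro tendsto_intros assms)

context sphere_minimizer
begin

text \<open>If \<open>D(X\<^sub>k,y)\<close> is positive for infinitely many \<open>k\<close>, then these \<open>X\<^sub>k\<close> span all the others and \<open>sign_extends\<close> makes all values
nonnegative; otherwise infinitely many values are at most zero, and hence all are. In the same way infinitely
many zeros force all values to vanish.\<close>

lemma sign_dichotomy:
  fixes X :: "nat \<Rightarrow> real^3"
  assumes X: "range X \<subseteq> K" and span: "\<forall>N k. infinite N \<longrightarrow> veronese (X k) \<in> span (veronese ` X ` N)"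
    and D: "\<And>i j. 0 \<le> D (X i) (X j)" and y: "y \<in> K"
  shows "(\<exists>k. 0 < D (X k) y) \<Longrightarrow> 0 \<le> D (X k) y"
    and "(\<exists>k. 0 < D (X k) y) \<Longrightarrow> \<forall>\<^sub>F k in sequentially. 0 < D (X k) y"
    and "\<not> (\<exists>k. 0 < D (X k) y) \<Longrightarrow>
           (\<forall>k. D (X k) y = 0) \<or> (\<forall>\<^sub>F k in sequentially. D (X k) y < 0)"
proof -
  let ?Z = "{k. D (X k) y = 0}"
  have zero: "\<forall>k. D (X k) y = 0" if "infinite ?Z"
    by (intro allI zero_extends[OF span[rule_format, OF that]]) simp
  then have ev: "\<forall>\<^sub>F k in sequentially. D (X k) y \<noteq> 0" if "\<not> (\<forall>k. D (X k) y = 0)"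
    using that unfolding cofinite_eq_sequentially[symmetric] eventually_cofinite by auto
  have sign: "(\<forall>x\<in>X ` N. 0 \<le> D x y) \<Longrightarrow> 0 \<le> D (X k) y" 
    "(\<forall>x\<in>X ` N. D x y \<le> 0) \<Longrightarrow> D (X k) y \<le> 0" if N: "infinite N" for N k
    by (rule sign_extends[OF _ _ span[rule_format, OF N] _ y]; use X D in blast)+
  have nonneg: "0 \<le> D (X k) y" if "\<exists>k. 0 < D (X k) y" for k
  proof (rule sign(1)[of "{k. 0 < D (X k) y}"])
    show "infinite {k. 0 < D (X k) y}"
    proof
      assume "finite {k. 0 < D (X k) y}"
      then have "infinite {k. D (X k) y \<le> 0}"
        using infinite_UNIV_nat finite_Un[of "{k. 0 < D (X k) y}" "{k. D (X k) y \<le> 0}"]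
        by (metis (mono_tags, lifting) UNIV_eq_I UnCI linorder_not_less mem_Collect_eq)
      from sign(2)[OF this] have "D (X k) y \<le> 0" for k by auto
      then show False using that by (simp add: not_less[symmetric])
    qed
  qed auto
  show "(\<exists>k. 0 < D (X k) y) \<Longrightarrow> 0 \<le> D (X k) y" by (rule nonneg)
  show "\<forall>\<^sub>F k in sequentially. 0 < D (X k) y" if P: "\<exists>k. 0 < D (X k) y"
    using ev nonneg[OF P] P by (auto elim!: eventually_mono simp: less_le)
  show "(\<forall>k. D (X k) y = 0) \<or> (\<forall>\<^sub>F k in sequentially. D (X k) y < 0)" if "\<not> (\<exists>k. 0 < D (X k) y)"
  proof (cases "\<forall>k. D (X k) y = 0")
    case False
    have "\<forall>\<^sub>F k in sequentially. D (X k) y < 0"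
      using ev[OF False] by eventually_elim (meson linorder_cases that)
    then show ?thesis ..
  qed simp
qed

text \<open>The contradiction compares the integral of the derivative of \<open>D(\<cdot>,y)\<close> at \<open>x\<close> over the set \<open>P\<close> from two sides: concavity
between \<open>x\<close> and a single point \<open>z\<close> of the sequence makes it positive in the direction \<open>u\<close> of \<open>z\<close>, while the first variation at the points
\<open>X\<^sub>k\<close> in directions tending to \<open>-u\<close> makes it nonpositive.\<close>

theorem finite_support:
  assumes \<tau>: "sqrt 6 < \<tau>"
  shows "finite K"
proof (rule ccontr)
  assume inf: "infinite K"
  have \<tau>0: "2 < \<tau>" "\<tau> \<noteq> 0" "0 < \<tau>"
  proof -
    have "(2::real) < sqrt 6" by (rule real_less_rsqrt) simp
    then show "2 < \<tau>" "\<tau> \<noteq> 0" "0 < \<tau>" using \<tau> by auto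
  qed
  define \<kappa> where "\<kappa> = (\<tau>\<^sup>2 - 1) * (\<tau>\<^sup>2 - 6) / \<tau>\<^sup>2"
  have q6: "6 < \<tau>\<^sup>2" using power_strict_mono[OF \<tau>, of 2] by simp
  then have \<kappa>: "0 < \<kappa>" unfolding \<kappa>_def by (intro divide_pos_pos mult_pos_pos) auto
  \<comment> \<open>Points within \<open>2 / \<tau>\<close> of each other have \<open>D \<ge> 0\<close>; the second bound leaves half of the concavity constant \<open>\<kappa>\<close>.\<close>
  define \<delta> where "\<delta> = min (1 / \<tau>) (\<kappa> / (4 * \<tau>\<^sup>2))"
  have \<delta>: "0 < \<delta>" "\<delta> \<le> 1 / \<tau>" "2 * \<tau>\<^sup>2 * \<delta> \<le> \<kappa> / 2"
    using \<kappa> \<tau>0 by (auto simp: \<delta>_def min_def field_simps)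
  have \<delta>2: "\<delta> < 1 / 2"
  proof -
    have "1 / \<tau> < 1 / 2" using \<tau>0 by (simp add: field_simps)
    then show ?thesis using \<delta>(2) by linarith
  qed
  obtain X x where injX: "inj X" and XK: "range X \<subseteq> K" and Xx: "X \<longlonglongrightarrow> x" and x: "x \<in> S2"
    and X_neq: "\<And>n. X n \<noteq> x" and X_near: "\<And>n. dist (X n) x < \<delta>"
    and span: "\<And>N k. infinite N \<Longrightarrow> veronese (X k) \<in> span (veronese ` X ` N)"
    using minimal_span_sequence[OF inf K_subset \<delta>(1)] by blast
  have XK': "X k \<in> K" for k using XK by auto
  then have X: "X k \<in> S2" for k using K_subset by blast
  have DX: "0 \<le> D (X i) (X j)" for i j
  proof (rule D_fun_nonneg_near[OF X X \<tau>0(3)])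
    show "dist (X i) (X j) \<le> 2 / \<tau>"
      using dist_triangle2[of "X i" "X j" x] X_near[of i] X_near[of j] \<delta>(2) by simp
  qed
  have "\<forall>N k. infinite N \<longrightarrow> veronese (X k) \<in> span (veronese ` X ` N)" using span by blast
  note sgn = sign_dichotomy[OF XK this DX]
  define P where "P y \<longleftrightarrow> (\<exists>k. 0 < D (X k) y)" for y
  have Dlim: "(\<lambda>k. D (X k) y) \<longlonglongrightarrow> D x y" for y by (rule tendsto_D_fun_left[OF Xx])
  have Dx_nonneg: "0 \<le> D x y" if "y \<in> K" "P y" for y
    using tendsto_lowerbound[OF Dlim] sgn(1)[OF that(1)] that(2) by (auto simp: P_def)
  have Dx_nonpos: "D x y \<le> 0" if "\<not> P y" for y
    using tendsto_upperbound[OF Dlim, of y 0] that by (auto simp: P_def not_less)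
  \<comment> \<open>\<open>D\<close> also vanishes for antipodal points, so its sign alone does not place \<open>x\<close> in the light cone of \<open>y\<close>.\<close>
  have inside: "1 - 2 / \<tau>\<^sup>2 \<le> x \<bullet> y" if y: "y \<in> K" "P y" for y
  proof -
    have yS: "y \<in> S2" using y K_subset by auto
    obtain k where "0 < D (X k) y" using y by (auto simp: P_def)
    then have "1 - 2 / \<tau>\<^sup>2 < X k \<bullet> y" by (rule D_fun_pos_imp[OF X yS _ \<tau>0(2)])
    moreover have "2 / \<tau>\<^sup>2 \<le> 1" using q6 by (auto simp: divide_le_eq_1)
    moreover have "X k \<bullet> y - x \<bullet> y \<le> dist (X k) x"
      using Cauchy_Schwarz_ineq2[of "X k - x" y] yS by (simp add: inner_diff_left dist_norm)
    ultimately have "0 < 1 + x \<bullet> y" using X_near[of k] \<delta>2 by linarith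
    moreover have "0 \<le> (1 + x \<bullet> y) * (2 - \<tau>\<^sup>2 * (1 - x \<bullet> y))"
      using Dx_nonneg[OF y] by (simp add: D_fun_def)
    ultimately have "0 \<le> 2 - \<tau>\<^sup>2 * (1 - x \<bullet> y)" by (simp add: zero_le_mult_iff)
    then show ?thesis using \<tau>0 by (simp add: field_simps)
  qed
  have pot_x: "potential x = S"
  proof -
    have lim: "(\<lambda>k. (1 + \<tau>\<^sup>2) / 2 * dist (X k) x) \<longlonglongrightarrow> (1 + \<tau>\<^sup>2) / 2 * dist x x"
      by (intro tendsto_intros Xx)
    have le: "\<bar>S - potential x\<bar> \<le> (1 + \<tau>\<^sup>2) / 2 * dist (X k) x" for k
      using potential_Lipschitz[OF X x, of k] potential_on_K[OF XK'] by simp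
    have "\<bar>S - potential x\<bar> \<le> (1 + \<tau>\<^sup>2) / 2 * dist x x"
      by (rule LIMSEQ_le_const[OF lim]) (use le in blast)
    then show ?thesis by simp
  qed
  define z where "z = X 0"
  define r where "r = dist x z"
  have r: "0 < r" "r < \<delta>" using X_neq[of 0] X_near[of 0] by (auto simp: r_def z_def dist_commute)
  define c where "c = r\<^sup>2 * \<kappa> / 8"
  have c: "0 < c" using r \<kappa> by (simp add: c_def)
  define w where "w = tangent x z"
  have concave: "D z y - D x y \<le> profile' \<tau> (x \<bullet> y) * (w \<bullet> y) - c"
    if "y \<in> S2" "1 - 2 / \<tau>\<^sup>2 \<le> x \<bullet> y" for y
  proof -
    have "D z y - D x y \<le> profile' \<tau> (x \<bullet> y) * (w \<bullet> y) - r\<^sup>2 / 4 * (\<kappa> - 2 * \<tau>\<^sup>2 * r)"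
      using D_fun_concave[OF x that(1) X[of 0] \<tau> that(2)] r \<delta>2
      by (simp add: w_def z_def r_def \<kappa>_def)
    moreover have "2 * \<tau>\<^sup>2 * r \<le> 2 * \<tau>\<^sup>2 * \<delta>" using r by (intro mult_left_mono) auto
    then have "r\<^sup>2 / 4 * (\<kappa> / 2) \<le> r\<^sup>2 / 4 * (\<kappa> - 2 * \<tau>\<^sup>2 * r)"
      using \<delta>(3) by (intro mult_left_mono) auto
    then have "c \<le> r\<^sup>2 / 4 * (\<kappa> - 2 * \<tau>\<^sup>2 * r)" by (simp add: c_def)
    ultimately show ?thesis by linarith
  qed
  have w0: "w \<noteq> 0"
  proof
    assume "w = 0"
    then have "(x \<bullet> z)\<^sup>2 = 1" using norm_tangent[OF x X[of 0]] by (simp add: w_def z_def)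
    moreover have "x \<bullet> z = 1 - r\<^sup>2 / 2" unfolding r_def using x X[of 0] by (intro inner_eq_dist) (auto simp: z_def)
    moreover have "0 < r\<^sup>2" "r\<^sup>2 < 1" using r \<delta>2 by (auto simp: power_less_one_iff)
    ultimately show False by (simp add: power2_eq_1_iff)
  qed
  define u where "u = w /\<^sub>R norm w"
  have u: "norm u = 1" "x \<bullet> u = 0"
    using w0 tangent_orthogonal[OF x, of z] by (auto simp: u_def w_def)
  have wu: "w = norm w *\<^sub>R u" using w0 by (simp add: u_def)
  \<comment> \<open>The direction \<open>u\<close> is tangent at \<open>x\<close> only, so it is projected to the tangent planes at the points \<open>X k\<close>.\<close>
  define v where "v k = u - (u \<bullet> X k) *\<^sub>R X k" for k
  have vu: "v \<longlonglongrightarrow> u"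
  proof -
    have "v \<longlonglongrightarrow> u - (u \<bullet> x) *\<^sub>R x" unfolding v_def by (intro tendsto_intros Xx)
    then show ?thesis using u by (simp add: inner_commute)
  qed
  define u' where "u' k = sgn (v k)" for k
  have u'u: "u' \<longlonglongrightarrow> u"
  proof -
    have "u' \<longlonglongrightarrow> sgn u" unfolding u'_def using u by (intro tendsto_sgn vu) auto
    then show ?thesis using u by (simp add: sgn_div_norm)
  qed
  have ev_v: "\<forall>\<^sub>F k in sequentially. v k \<noteq> 0"
    using tendsto_imp_eventually_ne[OF vu, of 0] u by force
  \<comment> \<open>The pointwise limit of the derivatives of \<open>L(\<cdot>,y)\<close> at \<open>X k\<close> in direction \<open>- u' k\<close>.\<close>
  define g where "g y = (if P y then - profile' \<tau> (x \<bullet> y) * (u \<bullet> y) else 0)" for y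
  have [measurable]: "Measurable.pred borel P"
    unfolding P_def D_fun_def by measurable
  have [measurable]: "g \<in> borel_measurable borel"
    unfolding g_def profile'_def by measurable
  have slope_lim: "(\<lambda>k. profile' \<tau> (X k \<bullet> y) * (- u' k \<bullet> y)) \<longlonglongrightarrow> - profile' \<tau> (x \<bullet> y) * (u \<bullet> y)" for y
  proof -
    have "(\<lambda>k. profile' \<tau> (X k \<bullet> y) * (- u' k \<bullet> y)) \<longlonglongrightarrow> profile' \<tau> (x \<bullet> y) * (- u \<bullet> y)"
      unfolding profile'_def by (intro tendsto_intros Xx u'u) auto
    then show ?thesis by simp
  qed
  have dlim: "(\<lambda>k. dLagrangian \<tau> (X k) (- u' k) y) \<longlonglongrightarrow> g y" if y: "y \<in> K" for y
  proof -
    have yS: "y \<in> S2" using y K_subset by auto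
    consider "P y" | "\<not> P y" "\<forall>\<^sub>F k in sequentially. D (X k) y < 0" | "\<not> P y" "\<forall>k. D (X k) y = 0"
      using sgn(3)[OF y] by (auto simp: P_def)
    then show ?thesis
    proof cases
      case 1
      then have "\<forall>\<^sub>F k in sequentially. profile' \<tau> (X k \<bullet> y) * (- u' k \<bullet> y) = dLagrangian \<tau> (X k) (- u' k) y"
        using sgn(2)[OF y] by (auto simp: P_def dLagrangian_def elim!: eventually_mono)
      then show ?thesis using Lim_transform_eventually[OF slope_lim] 1 by (simp add: g_def)
    next
      case 2
      then have "\<forall>\<^sub>F k in sequentially. dLagrangian \<tau> (X k) (- u' k) y = 0"
        by (auto simp: dLagrangian_def elim!: eventually_mono)
      then show ?thesis using 2 by (simp add: g_def tendsto_eventually)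
    next
      case 3
      have "(\<lambda>k. max 0 (profile' \<tau> (X k \<bullet> y) * (- u' k \<bullet> y))) \<longlonglongrightarrow> max 0 (- profile' \<tau> (x \<bullet> y) * (u \<bullet> y))"
        by (intro tendsto_max tendsto_const slope_lim)
      \<comment> \<open>Here \<open>y\<close> is antipodal to \<open>x\<close>, where \<open>D(\<cdot>,y)\<close> is stationary, or \<open>D(\<cdot>,y)\<close> vanishes at \<open>x\<close> and at \<open>z\<close> and is strictly concave in between, hence increasing from \<open>x\<close> towards \<open>z\<close>.\<close>
      also have "max 0 (- profile' \<tau> (x \<bullet> y) * (u \<bullet> y)) = 0"
      proof (rule max_absorb1)
        show "- profile' \<tau> (x \<bullet> y) * (u \<bullet> y) \<le> 0"
        proof -
          have "D x y = 0" using Dlim[of y] 3 LIMSEQ_unique[of "\<lambda>_. 0" "D x y" 0] by simp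
          then consider "x \<bullet> y = - 1" | "x \<bullet> y = 1 - 2 / \<tau>\<^sup>2"
            using D_fun_zero_imp \<tau>0(2) by blast
          then show ?thesis
          proof cases
            case 1
            then have "dist x (- y) = 0" using inner_eq_dist[of x "- y"] x yS by simp
            then have "y = - x" by simp
            then show ?thesis using u by (simp add: inner_commute)
          next
            case 2
            then have "0 - 0 \<le> profile' \<tau> (x \<bullet> y) * (w \<bullet> y) - c"
              using concave[OF yS] \<open>D x y = 0\<close> 3 by (simp add: z_def)
            then have "0 < profile' \<tau> (x \<bullet> y) * (w \<bullet> y)" using c by simp
            also have "\<dots> = norm w * (profile' \<tau> (x \<bullet> y) * (u \<bullet> y))"
              by (subst wu) (simp add: ac_simps)
            finally have "0 < profile' \<tau> (x \<bullet> y) * (u \<bullet> y)"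
              by (rule zero_less_mult_pos) (use w0 in simp)
            then show ?thesis by linarith
          qed
        qed
      qed
      finally show ?thesis using 3 by (simp only: g_def dLagrangian_def) simp
    qed
  qed
  have g_int: "0 \<le> (LINT y|\<rho>. g y)"
  proof (rule tendsto_lowerbound)
    show "(\<lambda>k. LINT y|\<rho>. dLagrangian \<tau> (X k) (- u' k) y) \<longlonglongrightarrow> (LINT y|\<rho>. g y)"
    proof (rule integral_dominated_convergence[where w="\<lambda>_. (1 + \<tau>\<^sup>2) / 2"])
      show "AE y in \<rho>. (\<lambda>k. dLagrangian \<tau> (X k) (- u' k) y) \<longlonglongrightarrow> g y"
        using AE_K dlim by (auto elim!: eventually_mono)
      have "\<bar>dLagrangian \<tau> (X k) (- u' k) y\<bar> \<le> (1 + \<tau>\<^sup>2) / 2" if "y \<in> S2" for k y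
      proof (cases "v k = 0")
        case True
        then show ?thesis by (simp add: u'_def dLagrangian_def)
      next
        case False
        then show ?thesis using abs_dLagrangian_le[OF X that] by (simp add: u'_def norm_sgn)
      qed
      then show "AE y in \<rho>. norm (dLagrangian \<tau> (X k) (- u' k) y) \<le> (1 + \<tau>\<^sup>2) / 2" for k
        by (intro AE_I2) simp
    qed auto
    show "\<forall>\<^sub>F k in sequentially. 0 \<le> (LINT y|\<rho>. dLagrangian \<tau> (X k) (- u' k) y)"
      using ev_v
    proof eventually_elim
      fix k assume "v k \<noteq> 0"
      moreover have "X k \<bullet> X k = 1" using X by (auto simp: dot_square_norm)
      then have "X k \<bullet> v k = 0" by (simp add: v_def inner_diff_right inner_commute[of u])
      ultimately show "0 \<le> (LINT y|\<rho>. dLagrangian \<tau> (X k) (- u' k) y)"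
        by (intro directional_derivative_nonneg X potential_on_K XK') (auto simp: u'_def norm_sgn sgn_div_norm)
    qed
  qed simp
  have gb: "\<bar>g y\<bar> \<le> (1 + \<tau>\<^sup>2) / 2" if "y \<in> S2" for y
  proof -
    have "\<bar>profile' \<tau> (x \<bullet> y)\<bar> * \<bar>u \<bullet> y\<bar> \<le> (1 + \<tau>\<^sup>2) / 2 * 1"
      using abs_profile'_le[OF inner_sphere_bound] inner_sphere_bound[of u y] u x that
      by (intro mult_mono) auto
    then show ?thesis by (simp add: g_def abs_mult)
  qed
  have ig: "integrable \<rho> g" by (rule integrable_bounded[OF _ gb]) simp
  define A where "A = {y \<in> space \<rho>. P y}"
  have A: "A \<in> sets \<rho>" unfolding A_def by measurable
  have AS: "A \<inter> S2 = A" by (auto simp: A_def)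
  have Ppos: "0 < measure \<rho> A"
  proof -
    have "open {y. 0 < D z y}"
      unfolding D_fun_def by (intro open_Collect_less continuous_intros)
    moreover have "z \<in> {y. 0 < D z y}" using D_fun_refl[OF X[of 0]] by (simp add: z_def)
    ultimately have "0 < measure \<rho> ({y. 0 < D z y} \<inter> S2)"
      using K_ball_pos XK'[of 0] by (simp add: z_def)
    also have "\<dots> \<le> measure \<rho> A"
      by (rule finite_measure_mono[OF _ A]) (auto simp: A_def P_def z_def)
    finally show ?thesis .
  qed
  have "0 = potential z - potential x" using pot_x potential_on_K[OF XK'[of 0]] by (simp add: z_def)
  also have "\<dots> = (LINT y|\<rho>. L z y - L x y)"
    unfolding potential_def using integrable_L[OF x] integrable_L[OF X[of 0]]
    by (simp add: z_def Bochner_Integration.integral_diff)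
  also have "\<dots> \<le> (LINT y|\<rho>. - norm w * g y - c * indicator A y)"
  proof (rule integral_mono_AE)
    show "integrable \<rho> (\<lambda>y. L z y - L x y)" using integrable_L[OF x] integrable_L[OF X[of 0]] by (simp add: z_def)
    show "integrable \<rho> (\<lambda>y. - norm w * g y - c * indicator A y)"
      using ig A AS by (intro Bochner_Integration.integrable_diff integrable_mult_right integrable_real_indicator) (auto simp: emeasure_eq_measure)
    show "AE y in \<rho>. L z y - L x y \<le> - norm w * g y - c * indicator A y"
      using AE_K
    proof eventually_elim
      fix y assume y: "y \<in> K"
      then have yS: "y \<in> S2" using K_subset by auto
      show "L z y - L x y \<le> - norm w * g y - c * indicator A y"
      proof (cases "P y")
        case True
        have "L z y - L x y = D z y - D x y"
          using Dx_nonneg[OF y True] sgn(1)[OF y] True by (simp add: Lagrangian_def P_def z_def)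
        also have "\<dots> \<le> profile' \<tau> (x \<bullet> y) * (w \<bullet> y) - c" by (rule concave[OF yS inside[OF y True]])
        also have "w \<bullet> y = norm w * (u \<bullet> y)" by (subst wu) simp
        finally show ?thesis using True yS by (simp add: g_def A_def ac_simps)
      next
        case False
        then have "D z y \<le> 0" "D x y \<le> 0" using Dx_nonpos by (auto simp: P_def z_def not_less)
        then show ?thesis using False by (simp add: Lagrangian_def g_def A_def)
      qed
    qed
  qed
  also have "\<dots> = - norm w * (LINT y|\<rho>. g y) - c * measure \<rho> A"
    using ig A AS by (subst Bochner_Integration.integral_diff) (auto simp: emeasure_eq_measure)
  also have "\<dots> < 0"
  proof -
    have "0 \<le> norm w * (LINT y|\<rho>. g y)" using g_int by simp
    moreover have "0 < c * measure \<rho> A" using c Ppos by simp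
    ultimately show ?thesis by simp
  qed
  finally show False by simp
qed

end

section \<open>Dimension and connectedness\<close>

lemma totally_disconnected_finite:
  fixes A :: "'a::metric_space set"
  assumes "finite A"
  shows "totally_disconnected A"
  unfolding totally_disconnected_def
proof (intro allI impI)
  fix C assume "C \<subseteq> A \<and> connected C"
  then show "C = {} \<or> (\<exists>x. C = {x})"
    using connected_finite_iff_sing[of C] finite_subset[OF _ assms] by auto
qed

lemma hausdorff_dim_finite:
  fixes A :: "'a::metric_space set"
  assumes A: "finite A" and s: "0 < s"
  shows "hausdorff_dim A \<le> ereal s"
proof (cases "A = {}")
  case True
  have "hausdorff_premeasure s \<delta> A = 0" if "0 < \<delta>" for \<delta>
  proof -
    have "hausdorff_premeasure s \<delta> A \<le> (\<Sum>i. ennreal (diam_pow s ((\<lambda>_. {}) i :: 'a set)))"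
      unfolding hausdorff_premeasure_def using True that by (intro INF_lower) auto
    then show ?thesis by (simp add: diam_pow_def)
  qed
  then have "hausdorff_measure s A = 0" by (simp add: hausdorff_measure_def)
  then show ?thesis unfolding hausdorff_dim_def using s by (intro INF_lower) auto
next
  case False
  then obtain f :: "nat \<Rightarrow> 'a" where f: "A = range f"
    using A countable_finite range_from_nat_into by metis
  have "hausdorff_premeasure s \<delta> A = 0" if "0 < \<delta>" for \<delta>
  proof -
    have "hausdorff_premeasure s \<delta> A \<le> (\<Sum>i. ennreal (diam_pow s {f i}))"
      unfolding hausdorff_premeasure_def using f that by (intro INF_lower) auto
    then show ?thesis using s by (simp add: diam_pow_def)
  qed
  then have "hausdorff_measure s A = 0" by (simp add: hausdorff_measure_def)
  then show ?thesis unfolding hausdorff_dim_def using s by (intro INF_lower) auto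
qed

theorem theorem1p2:
  fixes \<tau> :: real and \<rho> :: "(real^3) measure"
  assumes "\<tau> > sqrt 6"
    and "minimizing_measure \<tau> \<rho>"
  shows "totally_disconnected (measure_supp \<rho>) \<and> hausdorff_dim (measure_supp \<rho>) \<le> ereal (6/7)"
proof -
  interpret sphere_minimizer \<tau> \<rho> by unfold_locales (rule assms(2))
  have "finite K" by (rule finite_support[OF assms(1)])
  then show ?thesis by (simp add: totally_disconnected_finite hausdorff_dim_finite)
qed

end
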